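(* Let $(M,g)$ be a closed connected oriented smooth Riemannian manifold. The Riemann tensor $\mathbf R^{\mathrm{der}}$ of $\boldsymbol\nabla^{\mathrm{LC}}$ satisfies, for all $V^1,V^2,V^3,V^4\in\mathscr V\mathscr C^\infty_b$, the symmetry conditions \begin{align*} \mathbf R^{\mathrm{der}}(V^1,V^2)&=-\mathbf R^{\mathrm{der}}(V^2,V^1),\\ \mathbf G^{\mathrm{der}}\big(\mathbf R^{\mathrm{der}}(V^1,V^2)V^3,V^4\big)&=-\mathbf G^{\mathrm{der}}\big(\mathbf R^{\mathrm{der}}(V^1,V^2)V^4,V^3\big),\\ \mathbf G^{\mathrm{der}}\big(\mathbf R^{\mathrm{der}}(V^1,V^2)V^3,V^4\big)&=\mathbf G^{\mathrm{der}}\big(\mathbf R^{\mathrm{der}}(V^3,V^4)V^1,V^2\big), \end{align*} and the Bianchi identities \begin{align*} \mathbf R^{\mathrm{der}}(V^1,V^2)V^3+\mathbf R^{\mathrm{der}}(V^2,V^3)V^1+\mathbf R^{\mathrm{der}}(V^3,V^1)V^2&=0,\\ (\boldsymbol\nabla^{\mathrm{LC}}_{V^1}\mathbf R^{\mathrm{der}})(V^2,V^3)+(\boldsymbol\nabla^{\mathrm{LC}}_{V^2}\mathbf R^{\mathrm{der}})(V^3,V^1)+(\boldsymbol\nabla^{\mathrm{LC}}_{V^3}\mathbf R^{\mathrm{der}})(V^1,V^2)&=0. \end{align*}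
   Context: $\mathscr P$ is the set of Borel probability measures on $M$; $\mathfrak X^\infty$ the smooth vector fields on $M$; $\nabla^{\mathrm{LC}}$ the Levi-Civita connection of $(M,g)$. For $f\in C^\infty(M)$ put $f^\star(\mu)=\mu f=\int f\,d\mu$. Cylinder functions: $\mathscr F\mathscr C^\infty_b$ is the algebra of functions $u:\mathscr P\to\mathbb R$ of the form $u=F\circ(f_1^\star,\dots,f_k^\star)$, $k\in\mathbb N_0$, $F\in C^\infty(\mathbb R^k)$, $f_i\in C^\infty(M)$. Cylinder vector fields: $\mathscr V\mathscr C^\infty_b:=\mathscr F\mathscr C^\infty_b\otimes_{\mathbb R}\mathfrak X^\infty$ (algebraic tensor product), a module over $\mathscr F\mathscr C^\infty_b$; for $V=\sum_iu_i\otimes w_i$ set $V_\mu=\sum_iu_i(\mu)w_i\in\mathfrak X^\infty$. Differential: $\mathbf D_\mu u=\sum_i(\partial_iF)(f_1^\star\mu,\dots,f_k^\star\mu)\,df_i$ (independent of the representation of $u$). Action on functions: $(Vu)(\mu)=\int(\mathbf D_\mu u)(V_\mu)\,d\mu$, so $Vu\in\mathscr F\mathscr C^\infty_b$. The map sending $V$ to the derivation $u\mapsto Vu$ is injective, and cylinder vector fields are identified with the corresponding derivations. Bracket: $\llbracket V,Z\rrbracket\in\mathscr V\mathscr C^\infty_b$ is the cylinder vector field with $\llbracket V,Z\rrbracket u=V(Zu)-Z(Vu)$ for all $u\in\mathscr F\mathscr C^\infty_b$. Connections: $\boldsymbol\nabla^{\mathrm{int}}$ is determined by $\mathbb R$-linearity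 in $Z$ and $\boldsymbol\nabla^{\mathrm{int}}_V(u\otimes w)=(Vu)\otimes w$; $\big((\boldsymbol\Omega^{\mathrm{LC}}Z)V\big)_\mu=\nabla^{\mathrm{LC}}_{V_\mu}Z_\mu$; $\boldsymbol\nabla^{\mathrm{LC}}_VZ:=\boldsymbol\nabla^{\mathrm{int}}_VZ+(\boldsymbol\Omega^{\mathrm{LC}}Z)V$. Metric: $\mathbf G^{\mathrm{der}}_\mu(V,Z)=\int g(V_\mu,Z_\mu)\,d\mu$. Riemann tensor: $\mathbf R^{\mathrm{der}}(V^1,V^2)V^3:=\boldsymbol\nabla^{\mathrm{LC}}_{V^1}\boldsymbol\nabla^{\mathrm{LC}}_{V^2}V^3-\boldsymbol\nabla^{\mathrm{LC}}_{V^2}\boldsymbol\nabla^{\mathrm{LC}}_{V^1}V^3-\boldsymbol\nabla^{\mathrm{LC}}_{\llbracket V^1,V^2\rrbracket}V^3$. The connection induced on tensors is again denoted $\boldsymbol\nabla^{\mathrm{LC}}$: $(\boldsymbol\nabla^{\mathrm{LC}}_{V}\mathbf R^{\mathrm{der}})(X,Y)Z=\boldsymbol\nabla^{\mathrm{LC}}_V\big(\mathbf R^{\mathrm{der}}(X,Y)Z\big)-\mathbf R^{\mathrm{der}}(\boldsymbol\nabla^{\mathrm{LC}}_VX,Y)Z-\mathbf R^{\mathrm{der}}(X,\boldsymbol\nabla^{\mathrm{LC}}_VY)Z-\mathbf R^{\mathrm{der}}(X,Y)\boldsymbol\nabla^{\mathrm{LC}}_VZ$. *)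

theory Defs
  imports
    "HOL-Probability.Probability"
    "HOL-Library.Function_Algebras"
    "HOL-Combinatorics.Permutations"
begin

section \<open>Smooth functions on open subsets of Euclidean space\<close>

text \<open>
  The number of variables of a cylinder function is quantified inside the definition, so
  \<open>R^n\<close> is the library space \<^const>\<open>Euclidean_space\<close> \<open>n\<close>: the sequences \<open>nat \<Rightarrow> real\<close> that vanish from
  index \<open>n\<close> on, with the topology induced by the product topology.  The same model serves for
  charts, so that manifolds of dimension 0 are included.
\<close>

definition partial :: "nat \<Rightarrow> ((nat \<Rightarrow> real) \<Rightarrow> real) \<Rightarrow> (nat \<Rightarrow> real) \<Rightarrow> real" where
  "partial i F x = deriv (\<lambda>t. F (x(i := t))) (x i)"

primrec Ck_on :: "nat \<Rightarrow> nat \<Rightarrow> (nat \<Rightarrow> real) set \<Rightarrow> ((nat \<Rightarrow> real) \<Rightarrow> real) \<Rightarrow> bool" where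
  "Ck_on n 0 W F \<longleftrightarrow> continuous_on W F"
| "Ck_on n (Suc k) W F \<longleftrightarrow> continuous_on W F \<and>
     (\<forall>i<n. (\<forall>x\<in>W. (\<lambda>t. F (x(i := t))) differentiable (at (x i))) \<and> Ck_on n k W (partial i F))"

definition smooth_on :: "nat \<Rightarrow> (nat \<Rightarrow> real) set \<Rightarrow> ((nat \<Rightarrow> real) \<Rightarrow> real) \<Rightarrow> bool" where
  "smooth_on n W F \<longleftrightarrow> openin (Euclidean_space n) W \<and> (\<forall>k. Ck_on n k W F)"


section \<open>Oriented smooth manifolds\<close>

text \<open>
  The underlying topological space is the whole type \<open>'m\<close>.  A chart is a pair of its domain
  and its coordinate map.
\<close>

type_synonym 'm chart = "'m set \<times> ('m \<Rightarrow> nat \<Rightarrow> real)"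

record 'm manifold =
  mdim :: nat
  atlas :: "'m chart set"

definition is_chart :: "nat \<Rightarrow> 'm::topological_space chart \<Rightarrow> bool" where
  "is_chart n = (\<lambda>(U, \<phi>). open U \<and> openin (Euclidean_space n) (\<phi> ` U) \<and>
     homeomorphic_map (top_of_set U) (subtopology (Euclidean_space n) (\<phi> ` U)) \<phi>)"

definition transition :: "'m chart \<Rightarrow> 'm chart \<Rightarrow> nat \<Rightarrow> (nat \<Rightarrow> real) \<Rightarrow> real" where
  "transition c c' i = (\<lambda>y. snd c' (inv_into (fst c) (snd c) y) i)"

definition overlap :: "'m chart \<Rightarrow> 'm chart \<Rightarrow> (nat \<Rightarrow> real) set" where
  "overlap c c' = snd c ` (fst c \<inter> fst c')"

definition smooth_manifold :: "'m::{t2_space, second_countable_topology} manifold \<Rightarrow> bool" where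
  "smooth_manifold M \<longleftrightarrow>
     (\<forall>c\<in>atlas M. is_chart (mdim M) c) \<and>
     (\<Union>c\<in>atlas M. fst c) = UNIV \<and>
     (\<forall>c\<in>atlas M. \<forall>c'\<in>atlas M. \<forall>i<mdim M.
        smooth_on (mdim M) (overlap c c') (transition c c' i))"

text \<open>Determinant of the Jacobian matrix, whose size is a natural number, by the Leibniz formula.\<close>

definition jacobian_det :: "nat \<Rightarrow> (nat \<Rightarrow> (nat \<Rightarrow> real) \<Rightarrow> real) \<Rightarrow> (nat \<Rightarrow> real) \<Rightarrow> real" where
  "jacobian_det n \<tau> y =
     (\<Sum>p | p permutes {..<n}. of_int (sign p) * (\<Prod>i<n. partial (p i) (\<tau> i) y))"

text \<open>
  The orientation is carried by the atlas: all charts are positively oriented.  The atlas need not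
  be maximal; every notion below depends only on the smooth structure that it generates.
\<close>

definition oriented_smooth_manifold :: "'m::{t2_space, second_countable_topology} manifold \<Rightarrow> bool" where
  "oriented_smooth_manifold M \<longleftrightarrow> smooth_manifold M \<and>
     (\<forall>c\<in>atlas M. \<forall>c'\<in>atlas M. \<forall>y\<in>overlap c c'. jacobian_det (mdim M) (transition c c') y > 0)"

definition Cinf :: "'m::topological_space manifold \<Rightarrow> ('m \<Rightarrow> real) set" where
  "Cinf M = {f. \<forall>(U, \<phi>)\<in>atlas M. smooth_on (mdim M) (\<phi> ` U) (\<lambda>y. f (inv_into U \<phi> y))}"


section \<open>Vector fields, Riemannian metrics, Levi-Civita connections\<close>

type_synonym 'm vec = "('m \<Rightarrow> real) \<Rightarrow> real"
type_synonym 'm vfield = "'m \<Rightarrow> 'm vec"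

text \<open>
  Tangent vectors at \<open>x\<close> are the derivations of \<open>C\<^sup>\<infinity>(M)\<close> at \<open>x\<close>, extended by 0 to non-smooth functions
  in order to be determined by their values on \<open>C\<^sup>\<infinity>(M)\<close>.
\<close>

definition tangent_space :: "'m::topological_space manifold \<Rightarrow> 'm \<Rightarrow> 'm vec set" where
  "tangent_space M x = {v.
     (\<forall>f\<in>Cinf M. \<forall>h\<in>Cinf M. v (\<lambda>y. f y + h y) = v f + v h) \<and>
     (\<forall>f\<in>Cinf M. \<forall>c. v (\<lambda>y. c * f y) = c * v f) \<and>
     (\<forall>f\<in>Cinf M. \<forall>h\<in>Cinf M. v (\<lambda>y. f y * h y) = f x * v h + h x * v f) \<and>
     (\<forall>f. f \<notin> Cinf M \<longrightarrow> v f = 0)}"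

definition dir_deriv :: "'m vfield \<Rightarrow> ('m \<Rightarrow> real) \<Rightarrow> 'm \<Rightarrow> real" where
  "dir_deriv X f = (\<lambda>x. X x f)"

definition vfields :: "'m::topological_space manifold \<Rightarrow> 'm vfield set" where
  "vfields M = {X. (\<forall>x. X x \<in> tangent_space M x) \<and> (\<forall>f\<in>Cinf M. dir_deriv X f \<in> Cinf M)}"

definition fscale :: "('m \<Rightarrow> real) \<Rightarrow> 'm vfield \<Rightarrow> 'm vfield" where
  "fscale f X = (\<lambda>x \<phi>. f x * X x \<phi>)"

definition lie_bracket :: "'m vfield \<Rightarrow> 'm vfield \<Rightarrow> 'm vfield" where
  "lie_bracket X Y = (\<lambda>x f. X x (dir_deriv Y f) - Y x (dir_deriv X f))"

definition riemannian_metric ::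
  "'m::topological_space manifold \<Rightarrow> ('m \<Rightarrow> 'm vec \<Rightarrow> 'm vec \<Rightarrow> real) \<Rightarrow> bool" where
  "riemannian_metric M g \<longleftrightarrow>
     (\<forall>x. \<forall>u\<in>tangent_space M x. \<forall>v\<in>tangent_space M x.
        g x u v = g x v u \<and>
        (\<forall>w\<in>tangent_space M x. g x (u + v) w = g x u w + g x v w) \<and>
        (\<forall>c. g x (\<lambda>f. c * u f) v = c * g x u v) \<and>
        (u \<noteq> 0 \<longrightarrow> g x u u > 0)) \<and>
     (\<forall>X\<in>vfields M. \<forall>Y\<in>vfields M. (\<lambda>x. g x (X x) (Y x)) \<in> Cinf M)"

definition affine_connection ::
  "'m::topological_space manifold \<Rightarrow> ('m vfield \<Rightarrow> 'm vfield \<Rightarrow> 'm vfield) \<Rightarrow> bool" where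
  "affine_connection M nab \<longleftrightarrow>
     (\<forall>X\<in>vfields M. \<forall>Y\<in>vfields M. nab X Y \<in> vfields M \<and>
        (\<forall>Z\<in>vfields M. nab (X + Z) Y = nab X Y + nab Z Y \<and> nab X (Y + Z) = nab X Y + nab X Z) \<and>
        (\<forall>f\<in>Cinf M. nab (fscale f X) Y = fscale f (nab X Y) \<and>
           nab X (fscale f Y) = fscale (dir_deriv X f) Y + fscale f (nab X Y)))"

text \<open>By the fundamental theorem of Riemannian geometry exactly one connection on the smooth vector
  fields satisfies the following predicate.  Its values on other arguments are irrelevant.\<close>

definition levi_civita ::
  "'m::topological_space manifold \<Rightarrow> ('m \<Rightarrow> 'm vec \<Rightarrow> 'm vec \<Rightarrow> real) \<Rightarrow>
   ('m vfield \<Rightarrow> 'm vfield \<Rightarrow> 'm vfield) \<Rightarrow> bool" where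
  "levi_civita M g nab \<longleftrightarrow> affine_connection M nab \<and>
     (\<forall>X\<in>vfields M. \<forall>Y\<in>vfields M. nab X Y - nab Y X = lie_bracket X Y) \<and>
     (\<forall>X\<in>vfields M. \<forall>Y\<in>vfields M. \<forall>Z\<in>vfields M. \<forall>x.
        dir_deriv X (\<lambda>y. g y (Y y) (Z y)) x = g x (nab X Y x) (Z x) + g x (Y x) (nab X Z x))"


section \<open>Cylinder functions and cylinder vector fields\<close>

typedef (overloaded) 'm prob_meas =
  "{\<mu> :: 'm::topological_space measure. sets \<mu> = sets borel \<and> prob_space \<mu>}"
  morphisms meas Prob_meas
  by (rule exI [of _ "return borel undefined"]) (auto intro: prob_space_return)

definition star :: "('m::topological_space \<Rightarrow> real) \<Rightarrow> 'm prob_meas \<Rightarrow> real" where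
  "star f \<mu> = (\<integral>x. f x \<partial>meas \<mu>)"

definition stars :: "nat \<Rightarrow> (nat \<Rightarrow> 'm::topological_space \<Rightarrow> real) \<Rightarrow> 'm prob_meas \<Rightarrow> nat \<Rightarrow> real" where
  "stars k f \<mu> = (\<lambda>i. if i < k then star (f i) \<mu> else 0)"

definition cyl_rep ::
  "'m::topological_space manifold \<Rightarrow> ('m prob_meas \<Rightarrow> real) \<Rightarrow>
   nat \<Rightarrow> ((nat \<Rightarrow> real) \<Rightarrow> real) \<Rightarrow> (nat \<Rightarrow> 'm \<Rightarrow> real) \<Rightarrow> bool" where
  "cyl_rep M u k F f \<longleftrightarrow> smooth_on k (topspace (Euclidean_space k)) F \<and>
     (\<forall>i<k. f i \<in> Cinf M) \<and> u = (\<lambda>\<mu>. F (stars k f \<mu>))"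

definition cyl_funs :: "'m::topological_space manifold \<Rightarrow> ('m prob_meas \<Rightarrow> real) set" where
  "cyl_funs M = {u. \<exists>k F f. cyl_rep M u k F f}"

text \<open>
  The algebraic tensor product of a space \<open>A\<close> of real functions on a set \<open>P\<close> with a vector space \<open>B\<close>
  is realised inside the functions from \<open>P\<close> to \<open>B\<close>, with \<open>a \<otimes> b\<close> being the function
  \<open>\<mu> \<mapsto> a(\<mu>) b\<close>.  The lemma \<open>tensor_universal\<close> shows that no relations are added: every bilinear map on
  \<open>A \<times> B\<close> factors through this space.
\<close>

type_synonym 'm cvfield = "'m prob_meas \<Rightarrow> 'm vfield"

definition tensor :: "('p \<Rightarrow> real) \<Rightarrow> ('x \<Rightarrow> 'y \<Rightarrow> real) \<Rightarrow> 'p \<Rightarrow> 'x \<Rightarrow> 'y \<Rightarrow> real" where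
  "tensor u w = (\<lambda>\<mu> x \<phi>. u \<mu> * w x \<phi>)"

lemma tensor_universal:
  fixes A :: "('p \<Rightarrow> real) set" and B :: "('x \<Rightarrow> 'y \<Rightarrow> real) set"
    and b :: "('p \<Rightarrow> real) \<Rightarrow> ('x \<Rightarrow> 'y \<Rightarrow> real) \<Rightarrow> 'c::real_vector"
    and n :: nat
  assumes A: "\<And>u v c. u \<in> A \<Longrightarrow> v \<in> A \<Longrightarrow> u + v \<in> A \<and> (\<lambda>\<mu>. c * u \<mu>) \<in> A"
    and B: "\<And>w z c. w \<in> B \<Longrightarrow> z \<in> B \<Longrightarrow> w + z \<in> B \<and> (\<lambda>x \<phi>. c * w x \<phi>) \<in> B"
    and b1: "\<And>u v w c. u \<in> A \<Longrightarrow> v \<in> A \<Longrightarrow> w \<in> B \<Longrightarrow>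
               b (u + v) w = b u w + b v w \<and> b (\<lambda>\<mu>. c * u \<mu>) w = c *\<^sub>R b u w"
    and b2: "\<And>u w z c. u \<in> A \<Longrightarrow> w \<in> B \<Longrightarrow> z \<in> B \<Longrightarrow>
               b u (w + z) = b u w + b u z \<and> b u (\<lambda>x \<phi>. c * w x \<phi>) = c *\<^sub>R b u w"
    and uw: "\<And>i. i < n \<Longrightarrow> u i \<in> A" "\<And>i. i < n \<Longrightarrow> w i \<in> B"
    and zero: "(\<Sum>i<n. tensor (u i) (w i)) = 0"
  shows "(\<Sum>i<n. b (u i) (w i)) = 0"
proof -
  have app: "(\<Sum>i<m. tensor (u' i) (w' i)) \<mu> x \<phi> = (\<Sum>i<m. u' i \<mu> * w' i x \<phi>)"
    for m :: nat and u' :: "nat \<Rightarrow> 'p \<Rightarrow> real" and w' :: "nat \<Rightarrow> 'x \<Rightarrow> 'y \<Rightarrow> real" and \<mu> x \<phi>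
    by (induction m) (simp_all add: tensor_def)
  from uw zero show ?thesis
  proof (induction n arbitrary: u)
    case 0
    show ?case by simp
  next
    case (Suc n)
    have un: "u n \<in> A" and wn: "w n \<in> B" using Suc.prems by auto
    have ui: "u i \<in> A" and wi: "w i \<in> B" if "i < n" for i using Suc.prems that by auto
    have zero: "(\<Sum>i<n. u i \<mu> * w i x \<phi>) + u n \<mu> * w n x \<phi> = 0" for \<mu> x \<phi>
      using Suc.prems(3) app[where m="Suc n" and u'=u and w'=w and \<mu>=\<mu> and x=x and \<phi>=\<phi>]
      by (simp del: sum.lessThan_Suc add: sum.lessThan_Suc[where g="\<lambda>i. u i \<mu> * w i x \<phi>"])
    show ?case
    proof (cases "\<exists>\<mu>. u n \<mu> \<noteq> 0")
      case False
      then have eq: "u n = (\<lambda>\<mu>. 0 * u n \<mu>)" by auto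
      have "b (u n) (w n) = b (\<lambda>\<mu>. 0 * u n \<mu>) (w n)"
        by (rule arg_cong[OF eq, where f="\<lambda>z. b z (w n)"])
      then have "b (u n) (w n) = 0"
        using b1[OF un un wn, of 0] by simp
      moreover have "(\<Sum>i<n. tensor (u i) (w i)) = 0"
        using zero False by (auto simp: fun_eq_iff app)
      ultimately show ?thesis using Suc.IH[of u] ui wi by simp
    next
      case True
      then obtain \<nu> where \<nu>: "u n \<nu> \<noteq> 0" by blast
      define c where "c i = - u i \<nu> / u n \<nu>" for i
      define v where "v i = u i + (\<lambda>\<mu>. c i * u n \<mu>)" for i
      have vA: "v i \<in> A" if "i < n" for i
        unfolding v_def using A[OF un un] A[OF ui[OF that]] by blast
      have wn_eq: "w n x \<phi> = (\<Sum>i<n. c i * w i x \<phi>)" for x \<phi>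
      proof -
        have "w n x \<phi> = - (\<Sum>i<n. u i \<nu> * w i x \<phi>) / u n \<nu>"
          using zero[of \<nu> x \<phi>] \<nu> by (simp add: field_simps)
        then show ?thesis
          by (simp add: c_def sum_divide_distrib sum_negf)
      qed
      have "(\<Sum>i<n. tensor (v i) (w i)) = 0"
      proof (intro ext)
        fix \<mu> x \<phi>
        have "(\<Sum>i<n. v i \<mu> * w i x \<phi>) = (\<Sum>i<n. u i \<mu> * w i x \<phi>) + u n \<mu> * w n x \<phi>"
          by (simp add: v_def wn_eq sum.distrib sum_distrib_left algebra_simps)
        then show "(\<Sum>i<n. tensor (v i) (w i)) \<mu> x \<phi> = 0 \<mu> x \<phi>"
          using zero by (simp add: app)
      qed
      then have IH: "(\<Sum>i<n. b (v i) (w i)) = 0"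
        using Suc.IH[of v] vA wi by blast
      have bv: "b (v i) (w i) = b (u i) (w i) + c i *\<^sub>R b (u n) (w i)" if "i < n" for i
      proof -
        let ?t = "\<lambda>\<mu>. c i * u n \<mu>"
        have t: "?t \<in> A" using A[OF un un] by blast
        have "b (u i + ?t) (w i) = b (u i) (w i) + b ?t (w i)"
          using b1[OF ui[OF that] t wi[OF that]] by blast
        moreover have "b ?t (w i) = c i *\<^sub>R b (u n) (w i)"
          using b1[OF un un wi[OF that]] by blast
        ultimately show ?thesis unfolding v_def by (simp only:)
      qed
      have sums: "m \<le> n \<Longrightarrow> (\<lambda>x \<phi>. \<Sum>i<m. c i * w i x \<phi>) \<in> B \<and>
          b (u n) (\<lambda>x \<phi>. \<Sum>i<m. c i * w i x \<phi>) = (\<Sum>i<m. c i *\<^sub>R b (u n) (w i))" for m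
      proof (induction m)
        case 0
        have "(\<lambda>x \<phi>. 0 * w n x \<phi>) \<in> B" "b (u n) (\<lambda>x \<phi>. 0 * w n x \<phi>) = 0 *\<^sub>R b (u n) (w n)"
          using B[OF wn wn, of 0] b2[OF un wn wn, of 0] by blast+
        then show ?case by simp
      next
        case (Suc m)
        have wm: "w m \<in> B" using wi Suc.prems by simp
        let ?s = "\<lambda>x \<phi>. \<Sum>i<m. c i * w i x \<phi>" and ?t = "\<lambda>x \<phi>. c m * w m x \<phi>"
        have s: "?s \<in> B" "b (u n) ?s = (\<Sum>i<m. c i *\<^sub>R b (u n) (w i))"
          using Suc by auto
        have t: "?t \<in> B" "b (u n) ?t = c m *\<^sub>R b (u n) (w m)"
          using B[OF wm wm] b2[OF un wm wm] by blast+
        have st: "(\<lambda>x \<phi>. \<Sum>i<Suc m. c i * w i x \<phi>) = ?s + ?t"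
          by (simp add: fun_eq_iff)
        show ?case
          unfolding st using B[OF s(1) t(1)] b2[OF un s(1) t(1)]
          by (simp only: s(2) t(2) sum.lessThan_Suc simp_thms)
      qed
      have "w n = (\<lambda>x \<phi>. \<Sum>i<n. c i * w i x \<phi>)"
        using wn_eq by (simp add: fun_eq_iff)
      then have "b (u n) (w n) = (\<Sum>i<n. c i *\<^sub>R b (u n) (w i))"
        using sums[of n] by simp
      then show ?thesis
        using IH bv by (simp add: sum.distrib)
    qed
  qed
qed

definition cyl_vfields :: "'m::topological_space manifold \<Rightarrow> 'm cvfield set" where
  "cyl_vfields M = {V. \<exists>n u w. (\<forall>i<n. u i \<in> cyl_funs M) \<and> (\<forall>i<n. w i \<in> vfields M) \<and>
     V = (\<Sum>i<(n::nat). tensor (u i) (w i))}"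


section \<open>Differential, bracket, connections, curvature\<close>

definition dfun :: "'m::topological_space manifold \<Rightarrow> ('m \<Rightarrow> real) \<Rightarrow> 'm \<Rightarrow> 'm vec \<Rightarrow> real" where
  "dfun M f x v = (if v \<in> tangent_space M x then v f else 0)"

text \<open>The definite description expresses that the covector field does not depend on the
  representation of \<open>u\<close>.\<close>

definition differential ::
  "'m::topological_space manifold \<Rightarrow> ('m prob_meas \<Rightarrow> real) \<Rightarrow> 'm prob_meas \<Rightarrow> 'm \<Rightarrow> 'm vec \<Rightarrow> real" where
  "differential M u \<mu> = (THE \<omega>. \<exists>k F f. cyl_rep M u k F f \<and>
     \<omega> = (\<lambda>x v. \<Sum>i<k. partial i F (stars k f \<mu>) * dfun M (f i) x v))"

definition act :: "'m::topological_space manifold \<Rightarrow> 'm cvfield \<Rightarrow> ('m prob_meas \<Rightarrow> real) \<Rightarrow> 'm prob_meas \<Rightarrow> real" where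
  "act M V u = (\<lambda>\<mu>. \<integral>x. differential M u \<mu> x (V \<mu> x) \<partial>meas \<mu>)"

definition bracket :: "'m::topological_space manifold \<Rightarrow> 'm cvfield \<Rightarrow> 'm cvfield \<Rightarrow> 'm cvfield" where
  "bracket M V Z = (THE W. W \<in> cyl_vfields M \<and>
     (\<forall>u\<in>cyl_funs M. act M W u = act M V (act M Z u) - act M Z (act M V u)))"

text \<open>The condition \<open>T \<in> extensional (cyl_vfields M)\<close> only fixes the irrelevant values of \<open>T\<close>
  outside of the cylinder vector fields.\<close>

definition nabla_int :: "'m::topological_space manifold \<Rightarrow> 'm cvfield \<Rightarrow> 'm cvfield \<Rightarrow> 'm cvfield" where
  "nabla_int M V = (THE T. T \<in> extensional (cyl_vfields M) \<and>
     (\<forall>Y\<in>cyl_vfields M. \<forall>Z\<in>cyl_vfields M. T (Y + Z) = T Y + T Z) \<and>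
     (\<forall>Z\<in>cyl_vfields M. \<forall>c. T (\<lambda>\<mu> x \<phi>. c * Z \<mu> x \<phi>) = (\<lambda>\<mu> x \<phi>. c * T Z \<mu> x \<phi>)) \<and>
     (\<forall>u\<in>cyl_funs M. \<forall>w\<in>vfields M. T (tensor u w) = tensor (act M V u) w))"

definition Omega_LC :: "('m vfield \<Rightarrow> 'm vfield \<Rightarrow> 'm vfield) \<Rightarrow>
    'm::topological_space cvfield \<Rightarrow> 'm cvfield \<Rightarrow> 'm cvfield" where
  "Omega_LC nab Z V = (\<lambda>\<mu>. nab (V \<mu>) (Z \<mu>))"

definition nabla_LC :: "'m::topological_space manifold \<Rightarrow> ('m vfield \<Rightarrow> 'm vfield \<Rightarrow> 'm vfield) \<Rightarrow>
    'm cvfield \<Rightarrow> 'm cvfield \<Rightarrow> 'm cvfield" where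
  "nabla_LC M nab V Z = nabla_int M V Z + Omega_LC nab Z V"

definition G_der :: "('m::topological_space \<Rightarrow> 'm vec \<Rightarrow> 'm vec \<Rightarrow> real) \<Rightarrow>
    'm cvfield \<Rightarrow> 'm cvfield \<Rightarrow> 'm prob_meas \<Rightarrow> real" where
  "G_der g V Z = (\<lambda>\<mu>. \<integral>x. g x (V \<mu> x) (Z \<mu> x) \<partial>meas \<mu>)"

definition R_der :: "'m::topological_space manifold \<Rightarrow> ('m vfield \<Rightarrow> 'm vfield \<Rightarrow> 'm vfield) \<Rightarrow>
    'm cvfield \<Rightarrow> 'm cvfield \<Rightarrow> 'm cvfield \<Rightarrow> 'm cvfield" where
  "R_der M nab X Y Z = nabla_LC M nab X (nabla_LC M nab Y Z) - nabla_LC M nab Y (nabla_LC M nab X Z)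
     - nabla_LC M nab (bracket M X Y) Z"

definition nabla_R_der :: "'m::topological_space manifold \<Rightarrow> ('m vfield \<Rightarrow> 'm vfield \<Rightarrow> 'm vfield) \<Rightarrow>
    'm cvfield \<Rightarrow> 'm cvfield \<Rightarrow> 'm cvfield \<Rightarrow> 'm cvfield \<Rightarrow> 'm cvfield" where
  "nabla_R_der M nab V X Y Z = nabla_LC M nab V (R_der M nab X Y Z)
     - R_der M nab (nabla_LC M nab V X) Y Z
     - R_der M nab X (nabla_LC M nab V Y) Z
     - R_der M nab X Y (nabla_LC M nab V Z)"

end

theory Submission
  imports Defs
begin

text \<open>
  The differential of a cylinder function \<open>u = F(f\<^sub>1\<^sup>*, \<dots>, f\<^sub>k\<^sup>*)\<close> is independent of the representation,
  since the derivatives of \<open>u\<close> from \<open>\<mu>\<close> towards the Dirac measures determine \<open>\<Sum>\<^sub>i \<partial>\<^sub>iF f\<^sub>i\<close> up to a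
  constant.  A cylinder vector field \<open>W\<close> with \<open>\<integral> W\<^sub>\<mu> f d\<mu> = 0\<close> for all \<open>f\<close> and \<open>\<mu>\<close> is zero: the
  condition forces \<open>W\<^sub>\<mu>\<close> to vanish at the atoms of \<open>\<mu>\<close>, and every point becomes an atom after an
  arbitrarily small perturbation of \<open>\<mu>\<close>.  Hence the bracket exists uniquely, by the symmetry of second
  derivatives, and equals the pointwise Lie bracket plus
  \<open>\<nabla>\<^sup>i\<^sup>n\<^sup>t\<^sub>V Z - \<nabla>\<^sup>i\<^sup>n\<^sup>t\<^sub>Z V\<close>.

  So \<open>\<nabla>\<^sup>L\<^sup>C\<close> is torsion free and the bracket satisfies the Jacobi identity; the
  antisymmetry and both Bianchi identities follow from these two properties alone.  Moreover the curvature is, pointwise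
  in \<open>\<mu>\<close>, the Riemann tensor of \<open>M\<close>, so that its metric antisymmetry integrates to that of
  \<open>G\<^sup>d\<^sup>e\<^sup>r\<close>, and the pair symmetry is then formal.
\<close>

section \<open>Calculus on the spaces \<open>Euclidean_space n\<close>\<close>

text \<open>\<open>differential\<close>, \<open>nabla_int\<close> and \<open>bracket\<close> are
  definite descriptions, so each is given an explicit form together with a proof that it is the only
  candidate. The analytic obstacle is uniqueness of the bracket: a vector field \<open>X\<close>
  with vanishing integrals of all \<open>X f\<close> has to be recovered at an atom. Localisation is
  obtained from powers of smooth functions: putting \<open>f ^ Suc m\<close> for \<open>f\<close>
  shows that \<open>p(f) * X f\<close> integrates to zero for polynomials \<open>p\<close>, and
  suitable polynomials converge boundedly to the indicator of a zero set. Generic combinations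
  \<open>f + s * h\<close> lead to joint zero sets, and sums of squares with dominated convergence
  to countable intersections of them.

  The second key is that the components \<open>\<lambda>\<mu>. V \<mu> x \<phi>\<close> of a
  cylinder field are themselves cylinder functions. Derivations can therefore be applied to them one
  by one, which describes \<open>nabla_int\<close> without choosing a tensor representation; and
  they are continuous along mixtures with Dirac measures, which carries vanishing from perturbed
  measures back to the original one.\<close>

lemma Euclidean_space_mem: "x \<in> topspace (Euclidean_space n) \<longleftrightarrow> (\<forall>i\<ge>n. x i = 0)"
  by (simp add: topspace_Euclidean_space)

lemma Euclidean_space_upd:
  "x \<in> topspace (Euclidean_space n) \<Longrightarrow> i < n \<Longrightarrow> x(i := t) \<in> topspace (Euclidean_space n)"
  by (simp add: Euclidean_space_mem)

lemma continuous_on_fun_upd: "continuous_on UNIV (\<lambda>t. (x::nat \<Rightarrow> real)(i := t))"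
proof (rule continuous_on_coordinatewise_then_product)
  fix j show "continuous_on UNIV (\<lambda>t. (x(i := t)) j)"
    by (cases "j = i") (auto intro!: continuous_intros)
qed

text \<open>A relatively open set is cut out of the subspace by an open set of the product topology,
  and changing a coordinate below \<open>n\<close> does not leave the subspace. Hence
  \<open>partial\<close> at a point of \<open>W\<close> sees only the values on
  \<open>W\<close>.\<close>

lemma eventually_fun_upd_in_open:
  assumes "openin (Euclidean_space n) W" "x \<in> W" "i < n"
  shows "\<forall>\<^sub>F t in nhds (x i). x(i := t) \<in> W"
proof -
  from assms(1) obtain T where T: "open T" "W = T \<inter> {x. \<forall>i\<ge>n. x i = 0}"
    by (auto simp: Euclidean_space_def openin_subtopology euclidean_product_topology)
  have "open ((\<lambda>t. x(i := t)) -` T)"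
    using T(1) continuous_on_fun_upd by (intro open_vimage)
  then have "\<forall>\<^sub>F t in nhds (x i). t \<in> (\<lambda>t. x(i := t)) -` T"
    using assms T by (intro eventually_nhds_in_open) auto
  then show ?thesis
    by eventually_elim (use assms T in auto)
qed

lemma DERIV_partial:
  assumes "(\<lambda>t. F (x(i := t))) differentiable (at (x i))"
  shows "((\<lambda>t. F (x(i := t))) has_real_derivative partial i F x) (at (x i))"
  using assms by (simp add: partial_def DERIV_deriv_iff_real_differentiable)

lemma partial_eqI:
  "((\<lambda>t. F (x(i := t))) has_real_derivative d) (at (x i)) \<Longrightarrow> partial i F x = d"
  by (simp add: partial_def DERIV_imp_deriv)

lemma Ck_on_cong:
  assumes "openin (Euclidean_space n) W" and "\<And>x. x \<in> W \<Longrightarrow> F x = G x" and "Ck_on n k W F"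
  shows "Ck_on n k W G"
  using assms(2,3)
proof (induction k arbitrary: F G)
  case 0
  then show ?case by (simp cong: continuous_on_cong)
next
  case (Suc k)
  have *: "(\<lambda>t. G (x(i := t))) differentiable (at (x i)) \<and> partial i G x = partial i F x"
    if "x \<in> W" "i < n" for x i
  proof -
    have "((\<lambda>t. F (x(i := t))) has_real_derivative partial i F x) (at (x i))"
      using Suc.prems that by (intro DERIV_partial) auto
    moreover have "\<forall>\<^sub>F t in nhds (x i). F (x(i := t)) = G (x(i := t))"
      using eventually_fun_upd_in_open[OF assms(1) that] by eventually_elim (rule Suc.prems(1))
    ultimately have "((\<lambda>t. G (x(i := t))) has_real_derivative partial i F x) (at (x i))"
      using DERIV_cong_ev[where f = "\<lambda>t. F (x(i := t))" and g = "\<lambda>t. G (x(i := t))", OF refl _ refl] by simp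
    then show ?thesis
      by (metis partial_eqI real_differentiable_def)
  qed
  have "continuous_on W G"
    using Suc.prems by (simp cong: continuous_on_cong)
  moreover have "Ck_on n k W (partial i G)" if "i < n" for i
    using Suc.IH[of "partial i F" "partial i G"] * that Suc.prems by auto
  ultimately show ?case using * by simp
qed

lemma Ck_on_continuous: "Ck_on n k W F \<Longrightarrow> continuous_on W F"
  by (cases k) auto

lemma Ck_on_SucD: "Ck_on n (Suc k) W F \<Longrightarrow> Ck_on n k W F"
  by (induction k arbitrary: F) auto

lemma Ck_on_DERIV:
  "Ck_on n (Suc k) W F \<Longrightarrow> x \<in> W \<Longrightarrow> i < n \<Longrightarrow>
    ((\<lambda>t. F (x(i := t))) has_real_derivative partial i F x) (at (x i))"
  by (auto intro: DERIV_partial)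

text \<open>\<open>partial\<close> is an opaque \<open>deriv\<close>. Closure properties are proved
  by naming candidates \<open>F'\<close> for the derivatives; these agree with
  \<open>partial i F\<close> on \<open>W\<close> only, and \<open>Ck_on_cong\<close> bridges the
  difference.\<close>

lemma Ck_on_SucI:
  assumes W: "openin (Euclidean_space n) W" and "continuous_on W F"
    and "\<And>x i. x \<in> W \<Longrightarrow> i < n \<Longrightarrow> ((\<lambda>t. F (x(i := t))) has_real_derivative F' i x) (at (x i))"
    and "\<And>i. i < n \<Longrightarrow> Ck_on n k W (F' i)"
  shows "Ck_on n (Suc k) W F"
proof -
  have "Ck_on n k W (partial i F)" if "i < n" for i
    using Ck_on_cong[OF W _ assms(4)[OF that], of "partial i F"]
    by (simp add: partial_eqI[OF assms(3)] that)
  then show ?thesis using assms(2,3) by (auto simp: real_differentiable_def)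
qed

lemma Ck_on_const: "openin (Euclidean_space n) W \<Longrightarrow> Ck_on n k W (\<lambda>x. c)"
proof (induction k arbitrary: c)
  case (Suc k)
  then show ?case by (intro Ck_on_SucI[where F' = "\<lambda>i x. 0"]) auto
qed simp

lemma Ck_on_add:
  assumes W: "openin (Euclidean_space n) W" and "Ck_on n k W F" "Ck_on n k W G"
  shows "Ck_on n k W (\<lambda>x. F x + G x)"
  using assms(2,3)
proof (induction k arbitrary: F G)
  case (Suc k)
  then show ?case
    by (intro Ck_on_SucI[OF W, where F' = "\<lambda>i x. partial i F x + partial i G x"])
      (auto intro!: continuous_on_add DERIV_add Ck_on_DERIV simp del: fun_upd_apply)
qed (auto intro: continuous_on_add continuous_on_mult)

lemma DERIV_fun_upd_mult:
  assumes "((\<lambda>t. F (x(i := t))) has_real_derivative a) (at (x i))"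
    "((\<lambda>t. G (x(i := t))) has_real_derivative b) (at (x i))"
  shows "((\<lambda>t. F (x(i := t)) * G (x(i := t))) has_real_derivative a * G x + F x * b) (at (x i))"
  using DERIV_mult'[OF assms] by (simp add: add.commute)

lemma Ck_on_mult:
  assumes W: "openin (Euclidean_space n) W" and "Ck_on n k W F" "Ck_on n k W G"
  shows "Ck_on n k W (\<lambda>x. F x * G x)"
  using assms(2,3)
proof (induction k arbitrary: F G)
  case (Suc k)
  \<comment> \<open>The product rule leaves undifferentiated factors, so one order of
    differentiability of \<open>F\<close> and \<open>G\<close> is given away here.\<close>
  have FG: "Ck_on n k W F" "Ck_on n k W G"
    using Suc.prems Ck_on_SucD by blast+
  show ?case
  proof (rule Ck_on_SucI[OF W, where F' = "\<lambda>i x. partial i F x * G x + F x * partial i G x"])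
    show "continuous_on W (\<lambda>x. F x * G x)"
      using Suc.prems by (simp add: continuous_on_mult)
    show "((\<lambda>t. F (x(i := t)) * G (x(i := t))) has_real_derivative
        partial i F x * G x + F x * partial i G x) (at (x i))" if "x \<in> W" "i < n" for x i
      using Ck_on_DERIV[OF Suc.prems(1) that] Ck_on_DERIV[OF Suc.prems(2) that]
      by (rule DERIV_fun_upd_mult[where F = F and G = G and x = x and i = i])
    show "Ck_on n k W (\<lambda>x. partial i F x * G x + F x * partial i G x)" if "i < n" for i
    proof -
      have "Ck_on n k W (partial i F)" "Ck_on n k W (partial i G)"
        using that Suc.prems by auto
      then show ?thesis
        using FG by (intro Ck_on_add[OF W] Suc.IH)
    qed
  qed
qed (simp add: continuous_on_mult)

lemma smooth_on_const: "openin (Euclidean_space n) W \<Longrightarrow> smooth_on n W (\<lambda>x. c)"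
  by (simp add: smooth_on_def Ck_on_const)

lemma smooth_on_add: "smooth_on n W F \<Longrightarrow> smooth_on n W G \<Longrightarrow> smooth_on n W (\<lambda>x. F x + G x)"
  by (simp add: smooth_on_def Ck_on_add)

lemma smooth_on_mult: "smooth_on n W F \<Longrightarrow> smooth_on n W G \<Longrightarrow> smooth_on n W (\<lambda>x. F x * G x)"
  by (simp add: smooth_on_def Ck_on_mult)

lemma smooth_on_partial: "smooth_on n W F \<Longrightarrow> i < n \<Longrightarrow> smooth_on n W (partial i F)"
  unfolding smooth_on_def using Ck_on.simps(2)[of n _ W F] by blast

lemma smooth_on_Ck: "smooth_on n W F \<Longrightarrow> Ck_on n k W F"
  by (simp add: smooth_on_def)

lemma smooth_on_DERIV:
  "smooth_on n W F \<Longrightarrow> x \<in> W \<Longrightarrow> i < n \<Longrightarrow>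
    ((\<lambda>t. F (x(i := t))) has_real_derivative partial i F x) (at (x i))"
  by (rule Ck_on_DERIV) (rule smooth_on_Ck)

lemma partial_add:
  assumes "smooth_on n W F" "smooth_on n W G" "x \<in> W" "i < n"
  shows "partial i (\<lambda>x. F x + G x) x = partial i F x + partial i G x"
proof (rule partial_eqI)
  show "((\<lambda>t. F (x(i := t)) + G (x(i := t))) has_real_derivative partial i F x + partial i G x) (at (x i))"
    using smooth_on_DERIV[OF assms(1,3,4)] smooth_on_DERIV[OF assms(2-4)] by (rule DERIV_add)
qed

lemma partial_mult:
  assumes "smooth_on n W F" "smooth_on n W G" "x \<in> W" "i < n"
  shows "partial i (\<lambda>x. F x * G x) x = partial i F x * G x + F x * partial i G x"
proof (rule partial_eqI)
  show "((\<lambda>t. F (x(i := t)) * G (x(i := t))) has_real_derivative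
      partial i F x * G x + F x * partial i G x) (at (x i))"
    using smooth_on_DERIV[OF assms(1,3,4)] smooth_on_DERIV[OF assms(2-4)]
    by (rule DERIV_fun_upd_mult[where F = F and G = G and x = x and i = i])
qed

text \<open>Composition with \<open>select k \<sigma>\<close> regards a function of \<open>k\<close>
  variables as a function of other, possibly more, variables; it serves to write two cylinder
  functions over one list of generators. The cut-off at \<open>k\<close> keeps the values in
  \<open>Euclidean_space k\<close>.\<close>

definition select :: "nat \<Rightarrow> (nat \<Rightarrow> nat) \<Rightarrow> (nat \<Rightarrow> real) \<Rightarrow> nat \<Rightarrow> real" where
  "select k \<sigma> x = (\<lambda>i. if i < k then x (\<sigma> i) else 0)"

lemma select_mem: "select k \<sigma> x \<in> topspace (Euclidean_space k)"
  by (simp add: select_def Euclidean_space_mem)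

lemma continuous_on_select: "continuous_on A (select k \<sigma>)"
proof (rule continuous_on_coordinatewise_then_product)
  fix i show "continuous_on A (\<lambda>x. select k \<sigma> x i)"
    by (cases "i < k") (auto simp: select_def intro: continuous_on_subset[OF continuous_on_product_coordinates subset_UNIV])
qed

text \<open>By injectivity at most one coordinate of \<open>select k \<sigma> x\<close> moves with
  \<open>x j\<close>. The sum over all \<open>i\<close> avoids an inverse of
  \<open>\<sigma>\<close>, includes the case that no coordinate moves, and fits the closure of
  \<open>Ck_on\<close> under sums.\<close>

lemma DERIV_select:
  assumes F: "Ck_on k (Suc m) (topspace (Euclidean_space k)) F"
    and \<sigma>: "inj_on \<sigma> {..<k}"
  shows "((\<lambda>t. F (select k \<sigma> (x(j := t)))) has_real_derivative
    (\<Sum>i<k. if \<sigma> i = j then partial i F (select k \<sigma> x) else 0)) (at (x j))"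
proof (cases "\<exists>i<k. \<sigma> i = j")
  case True
  then obtain i where i: "i < k" "\<sigma> i = j" by blast
  have uniq: "i' < k \<Longrightarrow> \<sigma> i' = j \<longleftrightarrow> i' = i" for i'
    using \<sigma> i by (auto dest: inj_onD)
  then have "select k \<sigma> (x(j := t)) = (select k \<sigma> x)(i := t)" for t
    using i by (auto simp: select_def fun_eq_iff)
  moreover have "(\<Sum>i'<k. if \<sigma> i' = j then partial i' F (select k \<sigma> x) else 0) = partial i F (select k \<sigma> x)"
  proof -
    have "(\<Sum>i'<k. if \<sigma> i' = j then partial i' F (select k \<sigma> x) else 0) =
        (\<Sum>i'<k. if i' = i then partial i' F (select k \<sigma> x) else 0)"
      by (rule sum.cong) (simp_all add: uniq)
    then show ?thesis using i by simp
  qed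
  ultimately show ?thesis
    using Ck_on_DERIV[OF F select_mem i(1), of \<sigma> x] i by (simp add: select_def)
next
  case False
  then have "select k \<sigma> (x(j := t)) = select k \<sigma> x" for t
    by (auto simp: select_def fun_eq_iff)
  moreover have "(\<Sum>i<k. if \<sigma> i = j then partial i F (select k \<sigma> x) else 0) = 0"
    using False by (intro sum.neutral) auto
  ultimately show ?thesis by simp
qed

lemma openin_topspace_Euclidean: "openin (Euclidean_space n) (topspace (Euclidean_space n))"
  by simp

lemma Ck_on_sum:
  assumes "openin (Euclidean_space n) W" "\<And>i. i < m \<Longrightarrow> Ck_on n k W (F i)"
  shows "Ck_on n k W (\<lambda>x. \<Sum>i<m::nat. F i x)"
  using assms(2) by (induction m) (auto intro!: Ck_on_const Ck_on_add assms(1))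

lemma Ck_on_select:
  assumes "Ck_on k m (topspace (Euclidean_space k)) F" and \<sigma>: "inj_on \<sigma> {..<k}"
  shows "Ck_on n m (topspace (Euclidean_space n)) (\<lambda>x. F (select k \<sigma> x))"
  using assms(1)
proof (induction m arbitrary: F)
  case 0
  then show ?case
    by (auto intro!: continuous_on_compose2[OF _ continuous_on_select] simp: select_mem)
next
  case (Suc m)
  show ?case
  proof (rule Ck_on_SucI[OF openin_topspace_Euclidean])
    show "continuous_on (topspace (Euclidean_space n)) (\<lambda>x. F (select k \<sigma> x))"
      using Suc.prems by (auto intro!: continuous_on_compose2[OF _ continuous_on_select] simp: select_mem)
    show "((\<lambda>t. F (select k \<sigma> (x(j := t)))) has_real_derivative
      (\<Sum>i<k. if \<sigma> i = j then partial i F (select k \<sigma> x) else 0)) (at (x j))" for x j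
      by (rule DERIV_select[OF Suc.prems \<sigma>])
    have "Ck_on n m (topspace (Euclidean_space n)) (\<lambda>x. if \<sigma> i = j then partial i F (select k \<sigma> x) else 0)"
      if "i < k" for i j
      using that Suc by (cases "\<sigma> i = j") (auto intro: Ck_on_const)
    then show "Ck_on n m (topspace (Euclidean_space n))
        (\<lambda>x. \<Sum>i<k. if \<sigma> i = j then partial i F (select k \<sigma> x) else 0)" for j
      by (intro Ck_on_sum) auto
  qed
qed

lemma smooth_on_select:
  "smooth_on k (topspace (Euclidean_space k)) F \<Longrightarrow> inj_on \<sigma> {..<k} \<Longrightarrow>
    smooth_on n (topspace (Euclidean_space n)) (\<lambda>x. F (select k \<sigma> x))"
  by (simp add: smooth_on_def Ck_on_select)

lemma smooth_on_coordinate: "smooth_on n (topspace (Euclidean_space n)) (\<lambda>x. x i)"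
proof -
  have "Ck_on n k (topspace (Euclidean_space n)) (\<lambda>x. x i)" for k
  proof (cases k)
    case (Suc m)
    show ?thesis unfolding Suc
    proof (rule Ck_on_SucI[OF openin_topspace_Euclidean, where F' = "\<lambda>j x. if i = j then 1 else 0"])
      show "((\<lambda>t. (x(j := t)) i) has_real_derivative (if i = j then 1 else 0)) (at (x j))" for x j
        by auto
    qed (auto intro!: Ck_on_const continuous_on_subset[OF continuous_on_product_coordinates subset_UNIV])
  qed (auto intro!: continuous_on_subset[OF continuous_on_product_coordinates subset_UNIV])
  then show ?thesis by (simp add: smooth_on_def)
qed

section \<open>Directional derivatives and the symmetry of second partial derivatives\<close>

lemma mean_value_increment:
  assumes "\<And>s. (f has_real_derivative f' s) (at s)"
  shows "\<exists>\<theta>\<in>{0..1}. f (b + \<tau>) - f b = \<tau> * f' (b + \<theta> * \<tau>)"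
proof -
  have "((\<lambda>\<theta>. f (b + \<theta> * \<tau>)) has_real_derivative f' (b + \<theta> * \<tau>) * \<tau>) (at \<theta>)" for \<theta>
    by (rule DERIV_chain2[OF assms]) (auto intro!: derivative_eq_intros)
  then obtain \<theta> where "0 < \<theta>" "\<theta> < 1"
    "f (b + 1 * \<tau>) - f (b + 0 * \<tau>) = (1 - 0) * (f' (b + \<theta> * \<tau>) * \<tau>)"
    using MVT2[of 0 1 "\<lambda>\<theta>. f (b + \<theta> * \<tau>)" "\<lambda>\<theta>. f' (b + \<theta> * \<tau>) * \<tau>"] by auto
  then show ?thesis
    by (intro bexI[of _ \<theta>]) (auto simp: mult.commute)
qed

lemma tendsto_Euclidean_compose:
  assumes "continuous_on (topspace (Euclidean_space k)) F"
    and "\<And>t. \<xi> t \<in> topspace (Euclidean_space k)" "a \<in> topspace (Euclidean_space k)"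
    and "\<And>i. i < k \<Longrightarrow> ((\<lambda>t. \<xi> t i) \<longlongrightarrow> a i) net"
  shows "((\<lambda>t. F (\<xi> t)) \<longlongrightarrow> F a) net"
proof (rule continuous_on_tendsto_compose[OF assms(1)])
  have "((\<lambda>t. \<xi> t i) \<longlongrightarrow> a i) net" for i
    using assms by (cases "i < k") (auto simp: Euclidean_space_mem)
  then have "limitin (powertop_real UNIV) \<xi> a net"
    by (simp add: limitin_componentwise)
  then show "(\<xi> \<longlongrightarrow> a) net"
    by (simp add: euclidean_product_topology)
qed (use assms in auto)

lemma Ck_on_DERIV_Euclidean:
  assumes F: "Ck_on k (Suc m) (topspace (Euclidean_space k)) F"
    and "y \<in> topspace (Euclidean_space k)" "i < k"
  shows "((\<lambda>s. F (y(i := s))) has_real_derivative partial i F (y(i := s))) (at s)"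
  using Ck_on_DERIV[OF F Euclidean_space_upd[OF assms(2,3), of s] assms(3)] by simp

lemma partial_increment:
  assumes F: "Ck_on k (Suc m) (topspace (Euclidean_space k)) F"
    and "y \<in> topspace (Euclidean_space k)" "i < k"
  shows "\<exists>\<theta>\<in>{0..1}. F (y(i := b + \<tau>)) - F (y(i := b)) = \<tau> * partial i F (y(i := b + \<theta> * \<tau>))"
  using mean_value_increment[where f = "\<lambda>s. F (y(i := s))" and f' = "\<lambda>s. partial i F (y(i := s))",
      OF Ck_on_DERIV_Euclidean[OF assms]] .

text \<open>Continuous partial derivatives give derivatives along lines: the coordinates are moved
  one at a time, and the mean value theorem turns each increment into a partial derivative at an
  intermediate point, which tends to \<open>a\<close>. The induction counts the coordinates in which
  the direction may be nonzero.\<close>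

lemma has_directional_derivative:
  assumes F: "Ck_on k (Suc 0) (topspace (Euclidean_space k)) F"
    and a: "a \<in> topspace (Euclidean_space k)"
    and "m \<le> k" and "\<And>i. i \<ge> m \<Longrightarrow> v i = 0"
  shows "((\<lambda>t. F (\<lambda>i. a i + t * v i)) has_real_derivative (\<Sum>i<m. partial i F a * v i)) (at 0)"
  using assms(3,4)
proof (induction m arbitrary: v)
  case 0
  then have "v i = 0" for i by simp
  then show ?case by simp
next
  case (Suc m)
  define w where "w = v(m := 0)"
  define p where "p t = (\<lambda>i. a i + t * w i)" for t
  have p: "p t \<in> topspace (Euclidean_space k)" for t
    using a Suc.prems by (auto simp: Euclidean_space_mem p_def w_def)
  have mk: "m < k" using Suc.prems by simp
  have "\<forall>t. \<exists>\<theta>. \<theta> \<in> {0..1} \<and> F ((p t)(m := a m + t * v m)) - F ((p t)(m := a m))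
      = t * v m * partial m F ((p t)(m := a m + \<theta> * (t * v m)))"
    using partial_increment[OF F p mk] by blast
  then obtain \<theta> where \<theta>: "\<theta> t \<in> {0..1}"
    "F ((p t)(m := a m + t * v m)) - F ((p t)(m := a m))
      = t * v m * partial m F ((p t)(m := a m + \<theta> t * (t * v m)))" for t
    by metis
  have pm: "(p t)(m := a m) = p t" "(p t)(m := a m + t * v m) = (\<lambda>i. a i + t * v i)" for t
    by (auto simp: p_def w_def fun_eq_iff)
  have "((\<lambda>t. partial m F ((p t)(m := a m + \<theta> t * (t * v m)))) \<longlongrightarrow> partial m F a) (at 0)"
  proof (rule tendsto_Euclidean_compose[where k = k and F = "partial m F"])
    show "continuous_on (topspace (Euclidean_space k)) (partial m F)"
      using F mk by simp
    show "(p t)(m := a m + \<theta> t * (t * v m)) \<in> topspace (Euclidean_space k)" for t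
      by (intro Euclidean_space_upd p mk)
    have 1: "((\<lambda>t. a i + t * w i) \<longlongrightarrow> a i + 0 * w i) (at 0)" for i
      by (intro tendsto_intros)
    have "((\<lambda>t. \<theta> t * (t * v m)) \<longlongrightarrow> 0) (at 0)"
    proof (rule Lim_null_comparison[where g = "\<lambda>t. \<bar>t * v m\<bar>"])
      show "\<forall>\<^sub>F t in at 0. norm (\<theta> t * (t * v m)) \<le> \<bar>t * v m\<bar>"
        using \<theta>(1) by (auto simp: abs_mult intro!: always_eventually mult_left_le_one_le)
      show "((\<lambda>t. \<bar>t * v m\<bar>) \<longlongrightarrow> 0) (at 0)"
        by (auto intro!: tendsto_eq_intros)
    qed
    then have 2: "((\<lambda>t. a m + \<theta> t * (t * v m)) \<longlongrightarrow> a m + 0) (at 0)"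
      by (intro tendsto_intros)
    show "((\<lambda>t. ((p t)(m := a m + \<theta> t * (t * v m))) i) \<longlongrightarrow> a i) (at 0)" if "i < k" for i
      using 1[of i] 2 by (cases "i = m") (auto simp: p_def)
  qed (rule a)
  then have "((\<lambda>t. v m * partial m F ((p t)(m := a m + \<theta> t * (t * v m)))) \<longlongrightarrow> v m * partial m F a) (at 0)"
    by (intro tendsto_intros)
  moreover have "((\<lambda>t. (F (p t) - F a) / t) \<longlongrightarrow> (\<Sum>i<m. partial i F a * w i)) (at 0)"
    using Suc.IH[of w] Suc.prems unfolding p_def by (auto simp: DERIV_def w_def fun_upd_def)
  ultimately have "((\<lambda>t. (F (p t) - F a) / t + v m * partial m F ((p t)(m := a m + \<theta> t * (t * v m))))
      \<longlongrightarrow> (\<Sum>i<m. partial i F a * w i) + v m * partial m F a) (at 0)"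
    by (rule tendsto_add[rotated])
  moreover have "\<forall>\<^sub>F t in at 0. (F (p t) - F a) / t + v m * partial m F ((p t)(m := a m + \<theta> t * (t * v m)))
      = (F (\<lambda>i. a i + t * v i) - F a) / t"
    unfolding eventually_at_filter
  proof (rule always_eventually, intro allI impI)
    fix t :: real assume "t \<noteq> 0"
    have "F (\<lambda>i. a i + t * v i) = F (p t) + t * v m * partial m F ((p t)(m := a m + \<theta> t * (t * v m)))"
      using \<theta>(2)[of t] unfolding pm by simp
    with \<open>t \<noteq> 0\<close> show "(F (p t) - F a) / t + v m * partial m F ((p t)(m := a m + \<theta> t * (t * v m)))
      = (F (\<lambda>i. a i + t * v i) - F a) / t"
      by (simp add: field_simps)
  qed
  ultimately have "((\<lambda>t. (F (\<lambda>i. a i + t * v i) - F a) / t)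
      \<longlongrightarrow> (\<Sum>i<m. partial i F a * w i) + v m * partial m F a) (at 0)"
    by (rule Lim_transform_eventually)
  moreover have "(\<Sum>i<m. partial i F a * w i) = (\<Sum>i<m. partial i F a * v i)"
    by (rule sum.cong) (auto simp: w_def)
  ultimately show ?case
    by (simp add: DERIV_def mult.commute)
qed

text \<open>The numerator is symmetric in \<open>i\<close> and \<open>j\<close>, while the limit
  fixes an order of differentiation; exchanging the roles gives Schwarz's theorem. The mean value
  theorem is applied in direction \<open>i\<close> to the difference of \<open>F\<close> on two
  parallel lines, then in direction \<open>j\<close> to \<open>partial i F\<close>.\<close>

lemma second_difference_tendsto:
  assumes F: "Ck_on k 2 (topspace (Euclidean_space k)) F"
    and x: "x \<in> topspace (Euclidean_space k)" and ij: "i < k" "j < k" "i \<noteq> j"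
  shows "((\<lambda>h. (F (x(i := x i + h, j := x j + h)) - F (x(i := x i + h))
      - F (x(j := x j + h)) + F x) / (h * h)) \<longlongrightarrow> partial j (partial i F) x) (at 0)"
proof -
  have F2: "Ck_on k (Suc (Suc 0)) (topspace (Euclidean_space k)) F"
    using F by (simp add: numeral_2_eq_2)
  then have Fi: "Ck_on k (Suc 0) (topspace (Euclidean_space k)) (partial i F)"
    using ij by simp
  define D where "D h = F (x(i := x i + h, j := x j + h)) - F (x(i := x i + h))
      - F (x(j := x j + h)) + F x" for h
  have "\<exists>\<theta>\<in>{0..1}. \<exists>\<eta>\<in>{0..1}. D h = h * h * partial j (partial i F) (x(i := x i + \<theta> * h, j := x j + \<eta> * h))" for h
  proof -
    let ?y = "x(j := x j + h)"
    have d: "((\<lambda>s. F (?y(i := s)) - F (x(i := s))) has_real_derivative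
        partial i F (?y(i := s)) - partial i F (x(i := s))) (at s)" for s
      by (intro DERIV_diff Ck_on_DERIV_Euclidean[OF F2] Euclidean_space_upd x ij)
    obtain \<theta> where \<theta>: "\<theta> \<in> {0..1}" "F (?y(i := x i + h)) - F (x(i := x i + h)) - (F (?y(i := x i)) - F (x(i := x i)))
      = h * (partial i F (?y(i := x i + \<theta> * h)) - partial i F (x(i := x i + \<theta> * h)))"
      using mean_value_increment[where f = "\<lambda>s. F (?y(i := s)) - F (x(i := s))"
          and f' = "\<lambda>s. partial i F (?y(i := s)) - partial i F (x(i := s))", OF d] by blast
    let ?z = "x(i := x i + \<theta> * h)"
    obtain \<eta> where \<eta>: "\<eta> \<in> {0..1}" "partial i F (?z(j := x j + h)) - partial i F (?z(j := x j))
      = h * partial j (partial i F) (?z(j := x j + \<eta> * h))"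
      using partial_increment[OF Fi Euclidean_space_upd[OF x ij(1)] ij(2)] by blast
    have eqs: "?z(j := x j + h) = ?y(i := x i + \<theta> * h)" "?z(j := x j) = ?z"
      "?y(i := x i) = ?y" "?y(i := x i + h) = x(i := x i + h, j := x j + h)" "x(i := x i) = x"
      using ij by (auto simp: fun_eq_iff)
    have "D h = h * (partial i F (?z(j := x j + h)) - partial i F (?z(j := x j)))"
      using \<theta>(2) unfolding D_def eqs by simp
    then have "D h = h * h * partial j (partial i F) (x(i := x i + \<theta> * h, j := x j + \<eta> * h))"
      unfolding \<eta>(2) by simp
    then show ?thesis using \<theta>(1) \<eta>(1) by blast
  qed
  then obtain \<theta> \<eta> where te: "\<theta> h \<in> {0..1}" "\<eta> h \<in> {0..1}"
      "D h = h * h * partial j (partial i F) (x(i := x i + \<theta> h * h, j := x j + \<eta> h * h))" for h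
    by metis
  have small: "((\<lambda>h. c + \<theta> h * h) \<longlongrightarrow> c) (at 0)" if "\<And>h. \<theta> h \<in> {0..1}" for c and \<theta> :: "real \<Rightarrow> real"
  proof -
    have "((\<lambda>h. \<theta> h * h) \<longlongrightarrow> 0) (at 0)"
    proof (rule Lim_null_comparison[where g = "\<lambda>h. \<bar>h\<bar>"])
      show "\<forall>\<^sub>F h in at 0. norm (\<theta> h * h) \<le> \<bar>h\<bar>"
        using that by (auto simp: abs_mult intro!: always_eventually mult_left_le_one_le)
      show "((\<lambda>h. \<bar>h\<bar>) \<longlongrightarrow> 0) (at (0::real))"
        by (auto intro!: tendsto_eq_intros)
    qed
    from tendsto_add[OF tendsto_const this] show ?thesis by simp
  qed
  have "((\<lambda>h. partial j (partial i F) (x(i := x i + \<theta> h * h, j := x j + \<eta> h * h)))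
      \<longlongrightarrow> partial j (partial i F) x) (at 0)"
  proof (rule tendsto_Euclidean_compose[where k = k and F = "partial j (partial i F)"])
    show "continuous_on (topspace (Euclidean_space k)) (partial j (partial i F))"
      using Fi ij by simp
    show "x(i := x i + \<theta> h * h, j := x j + \<eta> h * h) \<in> topspace (Euclidean_space k)" for h
      by (intro Euclidean_space_upd x ij)
    show "((\<lambda>h. (x(i := x i + \<theta> h * h, j := x j + \<eta> h * h)) l) \<longlongrightarrow> x l) (at 0)" for l
      using small[of \<theta> "x i"] small[of \<eta> "x j"] te(1,2) by (cases "l = j"; cases "l = i") simp_all
  qed (rule x)
  then show ?thesis
    unfolding D_def[symmetric]
    by (rule Lim_transform_eventually) (auto simp: eventually_at_filter te(3))
qed

lemma partial_commute:
  assumes F: "Ck_on k 2 (topspace (Euclidean_space k)) F"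
    and x: "x \<in> topspace (Euclidean_space k)" and ij: "i < k" "j < k"
  shows "partial i (partial j F) x = partial j (partial i F) x"
proof (cases "i = j")
  case False
  have eq: "x(i := x i + h, j := x j + h) = x(j := x j + h, i := x i + h)" for h
    using False by auto
  show ?thesis
    using second_difference_tendsto[OF F x ij(2,1)] second_difference_tendsto[OF F x ij] False
    unfolding eq by (intro tendsto_unique[OF trivial_limit_at]) (auto simp: algebra_simps)
qed simp

section \<open>Probability measures and smooth functions on a closed manifold\<close>

lemma sets_meas [simp, measurable_cong]: "sets (meas \<mu>) = sets borel"
  and prob_space_meas [simp]: "prob_space (meas \<mu>)"
  using meas[of \<mu>] by auto

lemma space_meas [simp]: "space (meas \<mu>) = UNIV"
  using sets_eq_imp_space_eq[OF sets_meas] by simp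

lemma finite_measure_meas: "finite_measure (meas \<mu>)"
  using prob_space_meas prob_space_def by blast

lemma integrable_bounded_borel:
  fixes f :: "'a::topological_space \<Rightarrow> real"
  assumes "finite_measure N" "sets N = sets borel" "f \<in> borel_measurable borel" "\<And>x. \<bar>f x\<bar> \<le> C"
  shows "integrable N f"
proof -
  interpret finite_measure N by fact
  have "f \<in> borel_measurable N"
    using assms(3) measurable_cong_sets[OF assms(2) refl] by blast
  then show ?thesis using assms(4) by (intro integrable_const_bound[where B = C]) auto
qed

text \<open>The convex combination \<open>(1 - t) \<mu> + t \<delta>\<^sub>y\<close>.\<close>

definition mix :: "real \<Rightarrow> 'm::topological_space \<Rightarrow> 'm prob_meas \<Rightarrow> 'm prob_meas" where
  "mix t y \<mu> = Prob_meas (distr (measure_pmf (bernoulli_pmf t) \<Otimes>\<^sub>M meas \<mu>) borel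
     (\<lambda>(b, x). if b then y else x))"

lemma star_mix:
  fixes f :: "'m::topological_space \<Rightarrow> real"
  assumes t: "0 \<le> t" "t \<le> 1" and f: "f \<in> borel_measurable borel" and bound: "\<And>x. \<bar>f x\<bar> \<le> C"
  shows "star f (mix t y \<mu>) = (1 - t) * star f \<mu> + t * f y"
proof -
  let ?B = "measure_pmf (bernoulli_pmf t)" and ?h = "\<lambda>(b, x). if b then y else (x :: 'm)"
  interpret B: prob_space ?B by (rule prob_space_measure_pmf)
  interpret m: prob_space "meas \<mu>" by simp
  interpret P: pair_prob_space ?B "meas \<mu>" ..
  have h: "?h \<in> measurable (?B \<Otimes>\<^sub>M meas \<mu>) borel"
    by measurable
  have "meas (mix t y \<mu>) = distr (?B \<Otimes>\<^sub>M meas \<mu>) borel ?h"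
    unfolding mix_def using P.prob_space_distr[OF h] by (intro Prob_meas_inverse) simp
  then have "star f (mix t y \<mu>) = (\<integral>z. f (?h z) \<partial>(?B \<Otimes>\<^sub>M meas \<mu>))"
    using h f by (simp add: star_def integral_distr)
  also have "\<dots> = (\<integral>b. (\<integral>x. f (?h (b, x)) \<partial>meas \<mu>) \<partial>?B)"
  proof (rule P.integral_fst'[symmetric])
    show "integrable (?B \<Otimes>\<^sub>M meas \<mu>) (\<lambda>z. f (?h z))"
      using measurable_compose[OF h f] bound by (intro P.integrable_const_bound[where B = C]) auto
  qed
  also have "\<dots> = (1 - t) * star f \<mu> + t * f y"
    using t m.prob_space by (simp add: star_def)
  finally show ?thesis .
qed

lemma stars_mem: "stars k f \<mu> \<in> topspace (Euclidean_space k)"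
  by (simp add: stars_def Euclidean_space_mem)

locale closed_manifold =
  fixes M :: "'m::{t2_space, second_countable_topology} manifold"
  assumes smooth_manifold: "smooth_manifold M"
    and compact_UNIV: "compact (UNIV :: 'm set)"
begin

lemma openin_chart: "(U, \<phi>) \<in> atlas M \<Longrightarrow> openin (Euclidean_space (mdim M)) (\<phi> ` U)"
  using smooth_manifold by (auto simp: smooth_manifold_def is_chart_def)

lemma Cinf_const: "(\<lambda>x. c) \<in> Cinf M"
  by (auto simp: Cinf_def intro: smooth_on_const openin_chart)

lemma Cinf_add: "f \<in> Cinf M \<Longrightarrow> h \<in> Cinf M \<Longrightarrow> (\<lambda>x. f x + h x) \<in> Cinf M"
  by (auto simp: Cinf_def intro!: smooth_on_add)

lemma Cinf_mult: "f \<in> Cinf M \<Longrightarrow> h \<in> Cinf M \<Longrightarrow> (\<lambda>x. f x * h x) \<in> Cinf M"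
  by (auto simp: Cinf_def intro!: smooth_on_mult)

lemma Cinf_diff: "f \<in> Cinf M \<Longrightarrow> h \<in> Cinf M \<Longrightarrow> (\<lambda>x. f x - h x) \<in> Cinf M"
  using Cinf_add[OF _ Cinf_mult[OF Cinf_const[of "-1"]], of f h] by simp

lemma Cinf_power: "f \<in> Cinf M \<Longrightarrow> (\<lambda>x. f x ^ n) \<in> Cinf M"
  by (induction n) (auto intro: Cinf_const Cinf_mult)

lemma Cinf_sum: "(\<And>i. i < n \<Longrightarrow> f i \<in> Cinf M) \<Longrightarrow> (\<lambda>x. \<Sum>i<n::nat. f i x) \<in> Cinf M"
  by (induction n) (auto intro: Cinf_const Cinf_add)

text \<open>On a chart domain \<open>f\<close> is its coordinate representative composed with the
  coordinate map. Compactness then makes smooth functions bounded, hence integrable for every finite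
  Borel measure.\<close>

lemma Cinf_continuous:
  assumes "f \<in> Cinf M"
  shows "continuous_on UNIV f"
proof -
  have "isCont f x" for x
  proof -
    have "x \<in> (\<Union>c\<in>atlas M. fst c)"
      using smooth_manifold by (simp add: smooth_manifold_def)
    then obtain U \<phi> where c: "(U, \<phi>) \<in> atlas M" "x \<in> U" by force
    let ?E = "Euclidean_space (mdim M)"
    have U: "open U" and h: "homeomorphic_map (top_of_set U) (subtopology ?E (\<phi> ` U)) \<phi>"
      using c smooth_manifold by (auto simp: smooth_manifold_def is_chart_def)
    have "inj_on \<phi> U"
      using homeomorphic_imp_injective_map[OF h] by simp
    have "continuous_map (top_of_set U) (powertop_real UNIV) \<phi>"
      using homeomorphic_imp_continuous_map[OF h]
      by (simp add: Euclidean_space_def continuous_map_in_subtopology)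
    then have \<phi>: "continuous_on U \<phi>"
      by (simp add: euclidean_product_topology)
    have "smooth_on (mdim M) (\<phi> ` U) (\<lambda>y. f (inv_into U \<phi> y))"
      using assms c by (auto simp: Cinf_def)
    then have "continuous_on (\<phi> ` U) (\<lambda>y. f (inv_into U \<phi> y))"
      by (rule smooth_on_Ck[THEN Ck_on_continuous])
    then have "continuous_on U (\<lambda>x. f (inv_into U \<phi> (\<phi> x)))"
      using \<phi> by (rule continuous_on_compose2) simp
    then have "continuous_on U f"
      using \<open>inj_on \<phi> U\<close> by (simp cong: continuous_on_cong)
    then show ?thesis
      using U c continuous_on_eq_continuous_at by blast
  qed
  then show ?thesis by (simp add: continuous_at_imp_continuous_on)
qed

lemma Cinf_borel: "f \<in> Cinf M \<Longrightarrow> f \<in> borel_measurable borel"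
  by (intro borel_measurable_continuous_onI Cinf_continuous)

lemma Cinf_bounded:
  assumes "f \<in> Cinf M"
  obtains C where "C > 0" "\<And>x. \<bar>f x\<bar> \<le> C"
proof -
  have "bounded (range f)"
    using compact_continuous_image[OF Cinf_continuous[OF assms] compact_UNIV] by (rule compact_imp_bounded)
  then show ?thesis using that by (auto simp: bounded_pos)
qed

lemma Cinf_integrable:
  "f \<in> Cinf M \<Longrightarrow> finite_measure N \<Longrightarrow> sets N = sets borel \<Longrightarrow> integrable N f"
  by (metis Cinf_bounded Cinf_borel integrable_bounded_borel)

lemma integrable_meas: "f \<in> Cinf M \<Longrightarrow> integrable (meas \<mu>) f"
  by (simp add: Cinf_integrable finite_measure_meas)

lemma star_add: "f \<in> Cinf M \<Longrightarrow> h \<in> Cinf M \<Longrightarrow> star (\<lambda>x. f x + h x) \<mu> = star f \<mu> + star h \<mu>"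
  by (simp add: star_def integrable_meas)

lemma star_diff: "f \<in> Cinf M \<Longrightarrow> h \<in> Cinf M \<Longrightarrow> star (\<lambda>x. f x - h x) \<mu> = star f \<mu> - star h \<mu>"
  by (simp add: star_def integrable_meas)

lemma star_cmult: "star (\<lambda>x. c * f x) \<mu> = c * star f \<mu>"
  by (simp add: star_def)

lemma star_const [simp]: "star (\<lambda>x. c) \<mu> = c"
  using prob_space.prob_space[OF prob_space_meas, of \<mu>] by (simp add: star_def)

lemma star_mix_Cinf:
  "f \<in> Cinf M \<Longrightarrow> 0 \<le> t \<Longrightarrow> t \<le> 1 \<Longrightarrow> star f (mix t y \<mu>) = (1 - t) * star f \<mu> + t * f y"
  by (metis Cinf_bounded Cinf_borel star_mix)

section \<open>Tangent vectors and vector fields as derivations\<close>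

lemma tangent_add:
  "v \<in> tangent_space M x \<Longrightarrow> f \<in> Cinf M \<Longrightarrow> h \<in> Cinf M \<Longrightarrow> v (\<lambda>y. f y + h y) = v f + v h"
  by (auto simp: tangent_space_def)

lemma tangent_cmult: "v \<in> tangent_space M x \<Longrightarrow> f \<in> Cinf M \<Longrightarrow> v (\<lambda>y. c * f y) = c * v f"
  by (auto simp: tangent_space_def)

lemma tangent_mult:
  "v \<in> tangent_space M x \<Longrightarrow> f \<in> Cinf M \<Longrightarrow> h \<in> Cinf M \<Longrightarrow> v (\<lambda>y. f y * h y) = f x * v h + h x * v f"
  by (auto simp: tangent_space_def)

lemma tangent_nonsmooth: "v \<in> tangent_space M x \<Longrightarrow> f \<notin> Cinf M \<Longrightarrow> v f = 0"
  by (auto simp: tangent_space_def)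

text \<open>The Leibniz rule for the product \<open>1 * 1\<close> says that the value at the
  function 1 equals its own double.\<close>

lemma tangent_const:
  assumes "v \<in> tangent_space M x"
  shows "v (\<lambda>y. c) = 0"
  using tangent_mult[OF assms Cinf_const[of 1] Cinf_const[of 1]]
    tangent_cmult[OF assms Cinf_const[of 1], of c] by simp

lemma tangent_diff:
  assumes "v \<in> tangent_space M x" "f \<in> Cinf M" "h \<in> Cinf M"
  shows "v (\<lambda>y. f y - h y) = v f - v h"
  using tangent_add[OF assms(1,2) Cinf_mult[OF Cinf_const[of "-1"] assms(3)]]
    tangent_cmult[OF assms(1,3), of "-1"] by simp

lemma tangent_linear_combination:
  assumes "v \<in> tangent_space M x" "\<And>i. i < n \<Longrightarrow> f i \<in> Cinf M"
  shows "v (\<lambda>y. \<Sum>i<n::nat. c i * f i y) = (\<Sum>i<n. c i * v (f i))"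
  using assms(2)
proof (induction n)
  case (Suc n)
  have "v (\<lambda>y. (\<Sum>i<n. c i * f i y) + c n * f n y) = v (\<lambda>y. \<Sum>i<n. c i * f i y) + v (\<lambda>y. c n * f n y)"
    using Suc.prems by (intro tangent_add[OF assms(1)] Cinf_sum Cinf_mult Cinf_const) auto
  then show ?case using Suc by (simp add: tangent_cmult[OF assms(1)])
qed (simp add: tangent_const[OF assms(1)])

lemma zero_tangent: "0 \<in> tangent_space M x"
  by (simp add: tangent_space_def)

lemma tangent_space_add: "v \<in> tangent_space M x \<Longrightarrow> w \<in> tangent_space M x \<Longrightarrow> v + w \<in> tangent_space M x"
  by (simp add: tangent_space_def algebra_simps)

lemma tangent_space_cmult: "v \<in> tangent_space M x \<Longrightarrow> (\<lambda>f. c * v f) \<in> tangent_space M x"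
  by (simp add: tangent_space_def algebra_simps)

lemma vfields_tangent: "X \<in> vfields M \<Longrightarrow> X x \<in> tangent_space M x"
  by (simp add: vfields_def)

text \<open>Tangent vectors take the default value 0 on nonsmooth functions, so the claim extends to
  every \<open>f\<close>; facts about components of fields can then be stated for arbitrary
  \<open>f\<close>.\<close>

lemma dir_deriv_Cinf: "X \<in> vfields M \<Longrightarrow> dir_deriv X f \<in> Cinf M"
proof (cases "f \<in> Cinf M")
  case False
  assume "X \<in> vfields M"
  then have "dir_deriv X f = (\<lambda>x. 0)"
    using False by (auto simp: dir_deriv_def fun_eq_iff tangent_nonsmooth[OF vfields_tangent])
  then show ?thesis by (simp add: Cinf_const)
qed (simp add: vfields_def)

lemma vfield_Cinf: "X \<in> vfields M \<Longrightarrow> (\<lambda>x. X x f) \<in> Cinf M"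
  using dir_deriv_Cinf by (simp add: dir_deriv_def)

lemma vfields_zero: "0 \<in> vfields M"
  by (simp add: vfields_def zero_tangent dir_deriv_def Cinf_const)

lemma vfields_add: "X \<in> vfields M \<Longrightarrow> Y \<in> vfields M \<Longrightarrow> X + Y \<in> vfields M"
  by (auto simp: vfields_def tangent_space_add dir_deriv_def Cinf_add)

lemma vfields_cmult: "X \<in> vfields M \<Longrightarrow> (\<lambda>x \<phi>. c * X x \<phi>) \<in> vfields M"
  by (auto simp: vfields_def tangent_space_cmult dir_deriv_def Cinf_mult Cinf_const)

lemma vfields_minus: "X \<in> vfields M \<Longrightarrow> - X \<in> vfields M"
  using vfields_cmult[of X "-1"] by (simp add: fun_Compl_def)

lemma vfields_diff: "X \<in> vfields M \<Longrightarrow> Y \<in> vfields M \<Longrightarrow> X - Y \<in> vfields M"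
  using vfields_add[OF _ vfields_minus] by fastforce

end

section \<open>Cylinder functions and their derivatives\<close>

context closed_manifold
begin

lemma cyl_rep_value: "cyl_rep M u k F f \<Longrightarrow> u \<mu> = F (stars k f \<mu>)"
  by (simp add: cyl_rep_def)

lemma stars_mix:
  assumes "\<And>i. i < k \<Longrightarrow> f i \<in> Cinf M" "0 \<le> t" "t \<le> 1"
  shows "stars k f (mix t y \<mu>)
    = (\<lambda>i. stars k f \<mu> i + t * (if i < k then f i y - star (f i) \<mu> else 0))"
  using assms by (auto simp: stars_def fun_eq_iff star_mix_Cinf algebra_simps)

text \<open>Mixing with the Dirac measure at \<open>y\<close> moves \<open>stars k f \<mu>\<close>
  along a straight segment, so the limit is a directional derivative of \<open>F\<close>. It is
  one-sided because \<open>mix t y \<mu>\<close> is this convex combination for \<open>t\<close>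
  between 0 and 1.\<close>

lemma cyl_rep_mix_derivative:
  assumes u: "cyl_rep M u k F f"
  shows "((\<lambda>t. (u (mix t y \<mu>) - u \<mu>) / t) \<longlongrightarrow>
    (\<Sum>i<k. partial i F (stars k f \<mu>) * (f i y - star (f i) \<mu>))) (at_right 0)"
proof -
  define v where "v i = (if i < k then f i y - star (f i) \<mu> else 0)" for i
  have F: "Ck_on k (Suc 0) (topspace (Euclidean_space k)) F" and f: "i < k \<Longrightarrow> f i \<in> Cinf M" for i
    using u by (auto simp: cyl_rep_def intro: smooth_on_Ck simp del: Ck_on.simps)
  have "((\<lambda>t. F (\<lambda>i. stars k f \<mu> i + t * v i)) has_real_derivative
      (\<Sum>i<k. partial i F (stars k f \<mu>) * v i)) (at 0)"
    by (rule has_directional_derivative[OF F stars_mem order_refl]) (simp add: v_def)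
  then have "((\<lambda>t. (F (\<lambda>i. stars k f \<mu> i + t * v i) - u \<mu>) / t) \<longlongrightarrow>
      (\<Sum>i<k. partial i F (stars k f \<mu>) * v i)) (at_right 0)"
    by (auto simp: DERIV_def cyl_rep_value[OF u] intro: tendsto_within_subset)
  moreover have "\<forall>\<^sub>F t in at_right 0. (F (\<lambda>i. stars k f \<mu> i + t * v i) - u \<mu>) / t
      = (u (mix t y \<mu>) - u \<mu>) / t"
    by (rule eventually_at_rightI[of 0 1]) (auto simp: cyl_rep_value[OF u] stars_mix[OF f] v_def)
  ultimately have "((\<lambda>t. (u (mix t y \<mu>) - u \<mu>) / t) \<longlongrightarrow>
      (\<Sum>i<k. partial i F (stars k f \<mu>) * v i)) (at_right 0)"
    by (rule Lim_transform_eventually)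
  also have "(\<Sum>i<k. partial i F (stars k f \<mu>) * v i)
      = (\<Sum>i<k. partial i F (stars k f \<mu>) * (f i y - star (f i) \<mu>))"
    by (rule sum.cong) (auto simp: v_def)
  finally show ?thesis .
qed

text \<open>Right differentiability along the segment implies continuity: the increment is
  \<open>t\<close> times a convergent quotient.\<close>

lemma cyl_fun_mix_tendsto:
  assumes "u \<in> cyl_funs M"
  shows "((\<lambda>t. u (mix t y \<mu>)) \<longlongrightarrow> u \<mu>) (at_right 0)"
proof -
  from assms obtain k F f where u: "cyl_rep M u k F f" by (auto simp: cyl_funs_def)
  have "((\<lambda>t. t * ((u (mix t y \<mu>) - u \<mu>) / t) + u \<mu>) \<longlongrightarrow>
     0 * (\<Sum>i<k. partial i F (stars k f \<mu>) * (f i y - star (f i) \<mu>)) + u \<mu>) (at_right 0)"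
    by (intro tendsto_intros cyl_rep_mix_derivative[OF u])
  then have "((\<lambda>t. t * ((u (mix t y \<mu>) - u \<mu>) / t) + u \<mu>) \<longlongrightarrow> u \<mu>) (at_right 0)"
    by simp
  then show ?thesis
    by (rule Lim_transform_eventually) (auto simp: eventually_at_filter)
qed

text \<open>Perturbing \<open>\<mu>\<close> towards \<open>\<delta>\<^sub>y\<close> determines \<open>\<Sum>\<^sub>i \<partial>\<^sub>iF f\<^sub>i\<close> up to an additive constant,
  which tangent vectors annihilate.\<close>

lemma differential_eq:
  assumes u: "cyl_rep M u k F f"
  shows "differential M u \<mu> = (\<lambda>x v. \<Sum>i<k. partial i F (stars k f \<mu>) * dfun M (f i) x v)"
  unfolding differential_def
proof (rule the_equality)
  fix \<omega> assume "\<exists>k F f. cyl_rep M u k F f \<and>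
     \<omega> = (\<lambda>x v. \<Sum>i<k. partial i F (stars k f \<mu>) * dfun M (f i) x v)"
  then obtain l G h where w: "cyl_rep M u l G h"
    and \<omega>: "\<omega> = (\<lambda>x v. \<Sum>i<l. partial i G (stars l h \<mu>) * dfun M (h i) x v)" by blast
  have f: "i < k \<Longrightarrow> f i \<in> Cinf M" and h: "j < l \<Longrightarrow> h j \<in> Cinf M" for i j
    using u w by (auto simp: cyl_rep_def)
  let ?a = "\<lambda>i. partial i F (stars k f \<mu>)" and ?b = "\<lambda>i. partial i G (stars l h \<mu>)"
  define c where "c = (\<Sum>i<l. ?b i * star (h i) \<mu>) - (\<Sum>i<k. ?a i * star (f i) \<mu>)"
  have "(\<Sum>i<k. ?a i * (f i y - star (f i) \<mu>)) = (\<Sum>i<l. ?b i * (h i y - star (h i) \<mu>))" for y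
    by (rule tendsto_unique[OF _ cyl_rep_mix_derivative[OF u] cyl_rep_mix_derivative[OF w]]) simp
  then have *: "(\<Sum>i<l. ?b i * h i y) = (\<Sum>i<k. ?a i * f i y) + c" for y
    by (simp add: c_def right_diff_distrib sum_subtractf algebra_simps)
  have "(\<Sum>i<l. ?b i * dfun M (h i) x v) = (\<Sum>i<k. ?a i * dfun M (f i) x v)" for x v
  proof (cases "v \<in> tangent_space M x")
    case True
    have sm: "(\<lambda>y. \<Sum>i<k. ?a i * f i y) \<in> Cinf M"
      by (intro Cinf_sum Cinf_mult Cinf_const f)
    have "(\<Sum>i<l. ?b i * v (h i)) = v (\<lambda>y. \<Sum>i<l. ?b i * h i y)"
      by (rule tangent_linear_combination[OF True h, symmetric])
    also have "\<dots> = v (\<lambda>y. \<Sum>i<k. ?a i * f i y) + v (\<lambda>y. c)"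
      unfolding * by (rule tangent_add[OF True sm Cinf_const])
    also have "\<dots> = (\<Sum>i<k. ?a i * v (f i))"
      by (simp add: tangent_const[OF True] tangent_linear_combination[OF True f])
    finally show ?thesis using True by (simp add: dfun_def)
  qed (simp add: dfun_def)
  then show "\<omega> = (\<lambda>x v. \<Sum>i<k. ?a i * dfun M (f i) x v)"
    by (simp add: \<omega>)
qed (use u in blast)

lemma act_eq:
  assumes u: "cyl_rep M u k F f" and V: "V \<mu> \<in> vfields M"
  shows "act M V u \<mu> = (\<Sum>i<k. partial i F (stars k f \<mu>) * star (\<lambda>x. V \<mu> x (f i)) \<mu>)"
proof -
  have "act M V u \<mu> = (\<integral>x. (\<Sum>i<k. partial i F (stars k f \<mu>) * V \<mu> x (f i)) \<partial>meas \<mu>)"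
    by (simp add: act_def differential_eq[OF u] dfun_def vfields_tangent[OF V])
  also have "\<dots> = (\<Sum>i<k. partial i F (stars k f \<mu>) * star (\<lambda>x. V \<mu> x (f i)) \<mu>)"
    using vfield_Cinf[OF V] by (simp add: star_def integrable_meas)
  finally show ?thesis .
qed

section \<open>The algebra of cylinder functions\<close>

lemma cyl_rep_const: "cyl_rep M (\<lambda>\<mu>. c) 0 (\<lambda>x. c) (\<lambda>i x. 0)"
  by (simp add: cyl_rep_def smooth_on_const)

lemma cyl_rep_star: "f \<in> Cinf M \<Longrightarrow> cyl_rep M (star f) 1 (\<lambda>x. x 0) (\<lambda>i. f)"
  using smooth_on_coordinate[of 1 0] by (auto simp: cyl_rep_def stars_def)

lemma cyl_rep_select:
  assumes "cyl_rep M u k F f" "inj_on \<sigma> {..<k}" "\<sigma> ` {..<k} \<subseteq> {..<n}"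
    and "\<And>i. i < n \<Longrightarrow> h i \<in> Cinf M" "\<And>i. i < k \<Longrightarrow> h (\<sigma> i) = f i"
  shows "cyl_rep M u n (\<lambda>x. F (select k \<sigma> x)) h"
proof -
  have "select k \<sigma> (stars n h \<mu>) = stars k f \<mu>" for \<mu>
    using assms(3,5) by (intro ext) (auto simp: select_def stars_def)
  then show ?thesis
    using assms by (simp add: cyl_rep_def smooth_on_select)
qed

text \<open>The lists of generators are concatenated, and each outer function reads its own block of
  variables, the second one through the shift by \<open>k\<close>. Sums and products of cylinder
  functions then become sums and products of outer functions.\<close>

lemma cyl_rep_common:
  assumes "u \<in> cyl_funs M" "v \<in> cyl_funs M"
  obtains k F G f where "cyl_rep M u k F f" "cyl_rep M v k G f"
proof -
  from assms obtain k F f l G h where u: "cyl_rep M u k F f" and v: "cyl_rep M v l G h"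
    by (auto simp: cyl_funs_def)
  define e where "e i = (if i < k then f i else h (i - k))" for i
  have e: "e i \<in> Cinf M" if "i < k + l" for i
    using u v that by (auto simp: e_def cyl_rep_def)
  have "cyl_rep M u (k + l) (\<lambda>x. F (select k (\<lambda>i. i) x)) e"
    by (rule cyl_rep_select[OF u]) (auto intro: e, simp add: e_def)
  moreover have "cyl_rep M v (k + l) (\<lambda>x. G (select l (\<lambda>i. i + k) x)) e"
    by (rule cyl_rep_select[OF v]) (auto intro: e, simp add: e_def)
  ultimately show ?thesis using that by blast
qed

lemma cyl_rep_add:
  "cyl_rep M u k F f \<Longrightarrow> cyl_rep M v k G f \<Longrightarrow> cyl_rep M (\<lambda>\<mu>. u \<mu> + v \<mu>) k (\<lambda>x. F x + G x) f"
  by (auto simp: cyl_rep_def smooth_on_add)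

lemma cyl_rep_mult:
  "cyl_rep M u k F f \<Longrightarrow> cyl_rep M v k G f \<Longrightarrow> cyl_rep M (\<lambda>\<mu>. u \<mu> * v \<mu>) k (\<lambda>x. F x * G x) f"
  by (auto simp: cyl_rep_def smooth_on_mult)

lemma cyl_rep_partial:
  "cyl_rep M u k F f \<Longrightarrow> i < k \<Longrightarrow> cyl_rep M (\<lambda>\<mu>. partial i F (stars k f \<mu>)) k (partial i F) f"
  by (auto simp: cyl_rep_def smooth_on_partial)

lemma cyl_funs_const: "(\<lambda>\<mu>. c) \<in> cyl_funs M"
  unfolding cyl_funs_def by (blast intro: cyl_rep_const)

lemma cyl_funs_star: "f \<in> Cinf M \<Longrightarrow> star f \<in> cyl_funs M"
  unfolding cyl_funs_def by (blast intro: cyl_rep_star)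

lemma cyl_funs_add: "u \<in> cyl_funs M \<Longrightarrow> v \<in> cyl_funs M \<Longrightarrow> (\<lambda>\<mu>. u \<mu> + v \<mu>) \<in> cyl_funs M"
  by (erule (1) cyl_rep_common) (unfold cyl_funs_def, blast intro: cyl_rep_add)

lemma cyl_funs_mult: "u \<in> cyl_funs M \<Longrightarrow> v \<in> cyl_funs M \<Longrightarrow> (\<lambda>\<mu>. u \<mu> * v \<mu>) \<in> cyl_funs M"
  by (erule (1) cyl_rep_common) (unfold cyl_funs_def, blast intro: cyl_rep_mult)

lemma cyl_funs_sum:
  "(\<And>i. i < n \<Longrightarrow> u i \<in> cyl_funs M) \<Longrightarrow> (\<lambda>\<mu>. \<Sum>i<n::nat. u i \<mu>) \<in> cyl_funs M"
  by (induction n) (auto intro: cyl_funs_const cyl_funs_add)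

lemma cyl_funs_partial:
  "cyl_rep M u k F f \<Longrightarrow> i < k \<Longrightarrow> (\<lambda>\<mu>. partial i F (stars k f \<mu>)) \<in> cyl_funs M"
  unfolding cyl_funs_def by (blast intro: cyl_rep_partial)

lemma cyl_funs_minus: "u \<in> cyl_funs M \<Longrightarrow> (\<lambda>\<mu>. - u \<mu>) \<in> cyl_funs M"
  using cyl_funs_mult[OF cyl_funs_const[of "-1"]] by simp

section \<open>Cylinder vector fields as sums of pure tensors\<close>

lemma tensor_cyl_vfields:
  assumes "u \<in> cyl_funs M" "w \<in> vfields M"
  shows "tensor u w \<in> cyl_vfields M"
  unfolding cyl_vfields_def using assms
  by (auto intro!: exI[of _ "1::nat"] exI[of _ "\<lambda>_. u"] exI[of _ "\<lambda>_. w"])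

lemma cyl_vfields_zero: "0 \<in> cyl_vfields M"
  unfolding cyl_vfields_def by (auto intro!: exI[of _ "0::nat"])

text \<open>Identities additive in the field reduce to pure tensors, for whatever representation of
  the field is at hand.\<close>

lemma cyl_vfields_induct [consumes 1, case_names zero step]:
  assumes "V \<in> cyl_vfields M" and "P 0"
    and "\<And>V u w. V \<in> cyl_vfields M \<Longrightarrow> P V \<Longrightarrow> u \<in> cyl_funs M \<Longrightarrow> w \<in> vfields M \<Longrightarrow> P (V + tensor u w)"
  shows "P V"
proof -
  have "(\<Sum>i<n. tensor (u i) (w i)) \<in> cyl_vfields M \<and> P (\<Sum>i<n. tensor (u i) (w i))"
    if "\<forall>i<n. u i \<in> cyl_funs M" "\<forall>i<n. w i \<in> vfields M" for n :: nat and u w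
    using that
  proof (induction n)
    case 0
    then show ?case using cyl_vfields_zero assms(2) by (simp only: lessThan_0 sum.empty simp_thms)
  next
    case (Suc n)
    then have "P ((\<Sum>i<n. tensor (u i) (w i)) + tensor (u n) (w n))"
      by (intro assms(3)) auto
    moreover have "(\<Sum>i<Suc n. tensor (u i) (w i)) \<in> cyl_vfields M"
      unfolding cyl_vfields_def using Suc.prems by blast
    ultimately show ?case by (simp only: sum.lessThan_Suc simp_thms)
  qed
  then show ?thesis using assms(1) by (auto simp: cyl_vfields_def)
qed

lemma cyl_vfields_add_tensor:
  assumes "V \<in> cyl_vfields M" "u \<in> cyl_funs M" "w \<in> vfields M"
  shows "V + tensor u w \<in> cyl_vfields M"
proof -
  from assms(1) obtain n a b where "\<forall>i<n. a i \<in> cyl_funs M" "\<forall>i<n. b i \<in> vfields M"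
    "V = (\<Sum>i<(n::nat). tensor (a i) (b i))"
    unfolding cyl_vfields_def by blast
  then show ?thesis
    unfolding cyl_vfields_def using assms(2,3)
    by (intro CollectI exI[of _ "Suc n"] exI[of _ "a(n := u)"] exI[of _ "b(n := w)"]) auto
qed

lemma cyl_vfields_add:
  assumes "V \<in> cyl_vfields M" "Z \<in> cyl_vfields M"
  shows "V + Z \<in> cyl_vfields M"
  using assms(2)
proof (induction Z rule: cyl_vfields_induct)
  case zero
  show ?case unfolding add_0_right by (rule assms(1))
next
  case (step Z u w)
  then show ?case unfolding add.assoc[symmetric] by (intro cyl_vfields_add_tensor)
qed

lemma tensor_cmult: "(\<lambda>\<mu> x \<phi>. c * tensor u w \<mu> x \<phi>) = tensor (\<lambda>\<mu>. c * u \<mu>) w"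
  by (simp add: tensor_def mult.assoc)

lemma cyl_vfields_cmult:
  assumes "V \<in> cyl_vfields M"
  shows "(\<lambda>\<mu> x \<phi>. c * V \<mu> x \<phi>) \<in> cyl_vfields M"
  using assms
proof (induction V rule: cyl_vfields_induct)
  case zero
  then show ?case using cyl_vfields_zero by (simp add: zero_fun_def)
next
  case (step V u w)
  have "(\<lambda>\<mu> x \<phi>. c * (V + tensor u w) \<mu> x \<phi>)
      = (\<lambda>\<mu> x \<phi>. c * V \<mu> x \<phi>) + (\<lambda>\<mu> x \<phi>. c * tensor u w \<mu> x \<phi>)"
    by (simp add: fun_eq_iff algebra_simps)
  then show ?case
    using step by (simp add: tensor_cmult cyl_vfields_add_tensor cyl_funs_mult cyl_funs_const)
qed

lemma cyl_vfields_minus: "V \<in> cyl_vfields M \<Longrightarrow> - V \<in> cyl_vfields M"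
  using cyl_vfields_cmult[of V "-1"] by (simp add: fun_Compl_def)

lemma cyl_vfields_diff: "V \<in> cyl_vfields M \<Longrightarrow> Z \<in> cyl_vfields M \<Longrightarrow> V - Z \<in> cyl_vfields M"
  using cyl_vfields_add[OF _ cyl_vfields_minus] by fastforce

lemma cyl_vfield_at:
  assumes "V \<in> cyl_vfields M"
  shows "V \<mu> \<in> vfields M"
  using assms
proof (induction V rule: cyl_vfields_induct)
  case zero
  show "0 \<mu> \<in> vfields M" by (simp add: vfields_zero)
next
  case (step V u w)
  have "(V + tensor u w) \<mu> = V \<mu> + (\<lambda>x \<phi>. u \<mu> * w x \<phi>)"
    by (simp add: tensor_def)
  then show "(V + tensor u w) \<mu> \<in> vfields M"
    using step vfields_add vfields_cmult by metis
qed

text \<open>For fixed \<open>x\<close> and \<open>\<phi>\<close> a pure tensor contributes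
  \<open>u\<close> times the real constant \<open>w x \<phi>\<close>. This is what allows a
  derivation to act on a field component by component.\<close>

lemma cyl_vfield_component:
  assumes "V \<in> cyl_vfields M"
  shows "(\<lambda>\<mu>. V \<mu> x \<phi>) \<in> cyl_funs M"
  using assms
proof (induction V rule: cyl_vfields_induct)
  case zero
  show ?case by (simp add: cyl_funs_const)
next
  case (step V u w)
  then show ?case by (simp add: tensor_def cyl_funs_add cyl_funs_const cyl_funs_mult)
qed

section \<open>Cylinder vector fields as derivations of cylinder functions\<close>

lemma act_const: "V \<in> cyl_vfields M \<Longrightarrow> act M V (\<lambda>\<mu>. c) \<mu> = 0"
  by (simp add: act_eq[OF cyl_rep_const] cyl_vfield_at)

lemma act_star: "V \<in> cyl_vfields M \<Longrightarrow> f \<in> Cinf M \<Longrightarrow> act M V (star f) \<mu> = star (\<lambda>x. V \<mu> x f) \<mu>"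
  by (simp add: act_eq[OF cyl_rep_star] cyl_vfield_at partial_def)

lemma act_add:
  assumes V: "V \<in> cyl_vfields M" and "u \<in> cyl_funs M" "v \<in> cyl_funs M"
  shows "act M V (\<lambda>\<mu>. u \<mu> + v \<mu>) \<mu> = act M V u \<mu> + act M V v \<mu>"
proof -
  obtain k F G f where u: "cyl_rep M u k F f" and v: "cyl_rep M v k G f"
    by (rule cyl_rep_common[OF assms(2,3)])
  have "smooth_on k (topspace (Euclidean_space k)) F" "smooth_on k (topspace (Euclidean_space k)) G"
    using u v by (auto simp: cyl_rep_def)
  then have "partial i (\<lambda>x. F x + G x) (stars k f \<mu>) = partial i F (stars k f \<mu>) + partial i G (stars k f \<mu>)"
    if "i < k" for i
    using that by (intro partial_add[OF _ _ stars_mem])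
  then show ?thesis
    unfolding act_eq[OF u cyl_vfield_at[OF V]] act_eq[OF v cyl_vfield_at[OF V]]
      act_eq[OF cyl_rep_add[OF u v] cyl_vfield_at[OF V]] sum.distrib[symmetric]
    by (intro sum.cong) (simp_all add: distrib_right)
qed

lemma act_mult:
  assumes V: "V \<in> cyl_vfields M" and "u \<in> cyl_funs M" "v \<in> cyl_funs M"
  shows "act M V (\<lambda>\<mu>. u \<mu> * v \<mu>) \<mu> = act M V u \<mu> * v \<mu> + u \<mu> * act M V v \<mu>"
proof -
  obtain k F G f where u: "cyl_rep M u k F f" and v: "cyl_rep M v k G f"
    by (rule cyl_rep_common[OF assms(2,3)])
  have "smooth_on k (topspace (Euclidean_space k)) F" "smooth_on k (topspace (Euclidean_space k)) G"
    using u v by (auto simp: cyl_rep_def)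
  then have "partial i (\<lambda>x. F x * G x) (stars k f \<mu>)
      = partial i F (stars k f \<mu>) * v \<mu> + u \<mu> * partial i G (stars k f \<mu>)" if "i < k" for i
    unfolding cyl_rep_value[OF u] cyl_rep_value[OF v] using that by (intro partial_mult[OF _ _ stars_mem])
  then show ?thesis
    unfolding act_eq[OF u cyl_vfield_at[OF V]] act_eq[OF v cyl_vfield_at[OF V]]
      act_eq[OF cyl_rep_mult[OF u v] cyl_vfield_at[OF V]]
      sum.distrib[symmetric] sum_distrib_left sum_distrib_right
    by (intro sum.cong) (simp_all add: algebra_simps)
qed

lemma act_cmult:
  "V \<in> cyl_vfields M \<Longrightarrow> u \<in> cyl_funs M \<Longrightarrow> act M V (\<lambda>\<mu>. c * u \<mu>) \<mu> = c * act M V u \<mu>"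
  by (simp add: act_mult cyl_funs_const act_const)

lemma act_sum:
  assumes "V \<in> cyl_vfields M" "\<And>i. i < n \<Longrightarrow> u i \<in> cyl_funs M"
  shows "act M V (\<lambda>\<mu>. \<Sum>i<n::nat. u i \<mu>) \<mu> = (\<Sum>i<n. act M V (u i) \<mu>)"
  using assms(2)
proof (induction n)
  case 0
  then show ?case by (simp add: act_const[OF assms(1)])
next
  case (Suc n)
  then show ?case by (simp add: act_add[OF assms(1)] cyl_funs_sum)
qed

lemma act_add_vfield:
  assumes V: "V \<in> cyl_vfields M" and Z: "Z \<in> cyl_vfields M" and u: "u \<in> cyl_funs M"
  shows "act M (V + Z) u \<mu> = act M V u \<mu> + act M Z u \<mu>"
proof -
  from u obtain k F f where u: "cyl_rep M u k F f" by (auto simp: cyl_funs_def)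
  show ?thesis
    using cyl_vfield_at[OF V] cyl_vfield_at[OF Z]
    by (simp add: act_eq[OF u] vfields_add star_add vfield_Cinf distrib_left sum.distrib)
qed

lemma act_minus_vfield:
  assumes V: "V \<in> cyl_vfields M" and u: "u \<in> cyl_funs M"
  shows "act M (- V) u \<mu> = - act M V u \<mu>"
proof -
  from u obtain k F f where u: "cyl_rep M u k F f" by (auto simp: cyl_funs_def)
  show ?thesis
    using cyl_vfield_at[OF V]
    by (simp add: act_eq[OF u] vfields_minus sum_negf star_cmult[of "-1", simplified])
qed

lemma act_diff_vfield:
  "V \<in> cyl_vfields M \<Longrightarrow> Z \<in> cyl_vfields M \<Longrightarrow> u \<in> cyl_funs M \<Longrightarrow>
    act M (V - Z) u \<mu> = act M V u \<mu> - act M Z u \<mu>"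
  using act_add_vfield[OF _ cyl_vfields_minus] act_minus_vfield by fastforce

text \<open>The measure enters twice, through the coefficients of \<open>V\<close> and through the
  integration; on a pure tensor the two dependences separate into the product of \<open>u\<close>
  with \<open>star\<close> of a smooth function.\<close>

lemma star_cyl_vfield:
  assumes "V \<in> cyl_vfields M"
  shows "(\<lambda>\<mu>. star (\<lambda>x. V \<mu> x f) \<mu>) \<in> cyl_funs M"
  using assms
proof (induction V rule: cyl_vfields_induct)
  case zero
  then show ?case by (simp add: cyl_funs_const)
next
  case (step V u w)
  have "star (\<lambda>x. (V + tensor u w) \<mu> x f) \<mu> = star (\<lambda>x. V \<mu> x f) \<mu> + u \<mu> * star (\<lambda>x. w x f) \<mu>" for \<mu>
    using step cyl_vfield_at[OF step(1)]
    by (simp add: tensor_def star_add star_cmult vfield_Cinf Cinf_mult Cinf_const)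
  then show ?case
    using step by (simp add: cyl_funs_add cyl_funs_mult cyl_funs_star vfield_Cinf)
qed

lemma act_cyl_funs:
  assumes V: "V \<in> cyl_vfields M" and u: "u \<in> cyl_funs M"
  shows "act M V u \<in> cyl_funs M"
proof -
  from u obtain k F f where u: "cyl_rep M u k F f" by (auto simp: cyl_funs_def)
  have "act M V u = (\<lambda>\<mu>. \<Sum>i<k. partial i F (stars k f \<mu>) * star (\<lambda>x. V \<mu> x (f i)) \<mu>)"
    by (rule ext) (rule act_eq[OF u cyl_vfield_at[OF V]])
  then show ?thesis
    by (simp add: cyl_funs_sum cyl_funs_mult cyl_funs_partial[OF u] star_cyl_vfield[OF V])
qed

section \<open>Cylinder vector fields are determined by their action\<close>

lemma tangent_power:
  assumes "v \<in> tangent_space M x" "f \<in> Cinf M"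
  shows "v (\<lambda>y. f y ^ Suc m) = real (Suc m) * f x ^ m * v f"
proof (induction m)
  case (Suc m)
  have "v (\<lambda>y. f y * f y ^ Suc m) = f x * v (\<lambda>y. f y ^ Suc m) + f x ^ Suc m * v f"
    by (rule tangent_mult[OF assms Cinf_power[OF assms(2)]])
  then show ?case unfolding Suc by (simp add: algebra_simps)
qed simp

text \<open>By \<open>tangent_power\<close>, \<open>f x ^ m * X x f\<close> is a multiple of the
  derivative of \<open>f ^ Suc m\<close>, hence integrates to zero. Expanding one factor
  \<open>1 - (c * f x)\<^sup>2\<close> raises the exponent \<open>m\<close> by 2, so the induction
  on \<open>n\<close> keeps \<open>m\<close> arbitrary.\<close>

lemma integral_poly_mult_derivation:
  assumes N: "finite_measure N" "sets N = sets borel"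
    and X: "X \<in> vfields M" and zero: "\<And>f. f \<in> Cinf M \<Longrightarrow> (\<integral>x. X x f \<partial>N) = 0"
    and f: "f \<in> Cinf M"
  shows "(\<integral>x. (1 - (c * f x)\<^sup>2) ^ n * (f x ^ m * X x f) \<partial>N) = 0"
proof (induction n arbitrary: m)
  case 0
  have "f x ^ m * X x f = (1 / real (Suc m)) * X x (\<lambda>y. f y ^ Suc m)" for x
    unfolding tangent_power[OF vfields_tangent[OF X] f] by simp
  then show ?case
    using zero[OF Cinf_power[OF f, of "Suc m"]] by simp
next
  case (Suc n)
  let ?A = "\<lambda>m x. (1 - (c * f x)\<^sup>2) ^ n * (f x ^ m * X x f)"
  have "?A m \<in> Cinf M" for m
    by (intro Cinf_mult Cinf_power Cinf_diff Cinf_const f vfield_Cinf X)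
  then have "integrable N (?A m)" for m
    using N by (rule Cinf_integrable)
  moreover have "(1 - (c * f x)\<^sup>2) ^ Suc n * (f x ^ m * X x f) = ?A m x - c\<^sup>2 * ?A (m + 2) x" for x
    by (simp add: algebra_simps power2_eq_square)
  ultimately have "(\<integral>x. (1 - (c * f x)\<^sup>2) ^ Suc n * (f x ^ m * X x f) \<partial>N)
      = (\<integral>x. ?A m x \<partial>N) - c\<^sup>2 * (\<integral>x. ?A (m + 2) x \<partial>N)"
    by (simp only: Bochner_Integration.integral_diff integrable_mult_right integral_mult_right_zero)
  then show ?case unfolding Suc by simp
qed

text \<open>If \<open>C\<close> bounds \<open>f\<close>, then \<open>1 - (f x / C)\<^sup>2\<close>
  lies in the unit interval and equals 1 exactly on the zero set of \<open>f\<close>. Its powers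
  therefore converge to the indicator of that set, dominated by 1.\<close>

lemma integral_level_set_derivation:
  assumes N: "finite_measure N" "sets N = sets borel"
    and X: "X \<in> vfields M" and zero: "\<And>f. f \<in> Cinf M \<Longrightarrow> (\<integral>x. X x f \<partial>N) = 0"
    and f: "f \<in> Cinf M"
  shows "(\<integral>x. indicator {y. f y = 0} x * X x f \<partial>N) = 0"
proof -
  obtain C where C: "C > 0" "\<And>x. \<bar>f x\<bar> \<le> C" using Cinf_bounded[OF f] by blast
  have [measurable]: "f \<in> borel_measurable N" "(\<lambda>x. X x f) \<in> borel_measurable N"
    using Cinf_integrable[OF f N] Cinf_integrable[OF vfield_Cinf[OF X] N] by auto
  define e where "e x = 1 - (1 / C * f x)\<^sup>2" for x
  have e: "0 \<le> e x" "e x \<le> 1" for x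
    using C(2)[of x] C(1) by (auto simp: e_def abs_square_le_1 divide_le_eq)
  have "(\<lambda>n. \<integral>x. e x ^ n * X x f \<partial>N) \<longlonglongrightarrow> (\<integral>x. indicator {y. f y = 0} x * X x f \<partial>N)"
  proof (rule integral_dominated_convergence[where w = "\<lambda>x. \<bar>X x f\<bar>"])
    show "integrable N (\<lambda>x. \<bar>X x f\<bar>)"
      using Cinf_integrable[OF vfield_Cinf[OF X] N] by simp
    show "AE x in N. (\<lambda>n. e x ^ n * X x f) \<longlonglongrightarrow> indicator {y. f y = 0} x * X x f"
    proof (intro AE_I2 tendsto_intros)
      fix x
      show "(\<lambda>n. e x ^ n) \<longlonglongrightarrow> indicator {y. f y = 0} x"
      proof (cases "f x = 0")
        case False
        then have "e x < 1" using C by (simp add: e_def)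
        then show ?thesis using e[of x] False by (simp add: LIMSEQ_realpow_zero)
      qed (simp add: e_def)
    qed
    show "AE x in N. norm (e x ^ n * X x f) \<le> \<bar>X x f\<bar>" for n
      using e by (auto simp: abs_mult power_abs intro!: mult_left_le_one_le power_le_one)
  qed (auto simp: e_def)
  moreover have "(\<integral>x. e x ^ n * X x f \<partial>N) = 0" for n
    using integral_poly_mult_derivation[OF N X zero f, of "1 / C" n 0] by (simp add: e_def)
  ultimately show ?thesis by (simp add: LIMSEQ_const_iff)
qed

text \<open>For all but countably many \<open>s\<close>, the set \<open>{f + s h = 0}\<close> agrees with \<open>{f = 0, h = 0}\<close> almost
  everywhere, since \<open>{f + s h = 0, h \<noteq> 0}\<close> is the fibre of \<open>- f / h\<close> over \<open>s\<close>.\<close>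

lemma integral_joint_level_set_derivation:
  assumes N: "finite_measure N" "sets N = sets borel"
    and X: "X \<in> vfields M" and zero: "\<And>f. f \<in> Cinf M \<Longrightarrow> (\<integral>x. X x f \<partial>N) = 0"
    and f: "f \<in> Cinf M" and h: "h \<in> Cinf M"
  shows "(\<integral>x. indicator {y. f y = 0 \<and> h y = 0} x * X x f \<partial>N) = 0"
proof -
  interpret finite_measure N by fact
  have [measurable]: "f \<in> borel_measurable N" "h \<in> borel_measurable N"
    and int: "integrable N (\<lambda>x. X x f)" "integrable N (\<lambda>x. X x h)"
    using Cinf_integrable[OF _ N] f h vfield_Cinf[OF X] by auto
  then have [measurable]: "(\<lambda>x. X x f) \<in> borel_measurable N" "(\<lambda>x. X x h) \<in> borel_measurable N"
    by auto
  have "{y \<in> space N. f y = 0 \<and> h y = 0} \<in> sets N"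
    by measurable
  then have Z: "{y. f y = 0 \<and> h y = 0} \<in> sets N"
    using sets_eq_imp_space_eq[OF N(2)] by simp
  define r where "r y = - f y / h y" for y
  have r [measurable]: "r \<in> borel_measurable N" by (simp add: r_def[abs_def])
  define B where "B = {s. measure (distr N borel r) {s} \<noteq> 0}"
  interpret D: finite_measure "distr N borel r"
    using r by (rule finite_measure_distr)
  have "countable B" unfolding B_def by (rule D.countable_support)
  have outside: "\<exists>s. s \<notin> A" if "countable A" for A :: "real set"
    using that uncountable_UNIV_real by (metis UNIV_eq_I)
  \<comment> \<open>Each \<open>s\<close> outside \<open>B\<close> yields one linear equation for
    \<open>J f\<close> and \<open>J h\<close>; two distinct values make the system nonsingular, so
    both integrals vanish.\<close>
  obtain s1 where s1: "s1 \<notin> insert 0 B"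
    using outside[of "insert 0 B"] \<open>countable B\<close> by blast
  obtain s2 where s2: "s2 \<notin> insert s1 (insert 0 B)"
    using outside[of "insert s1 (insert 0 B)"] \<open>countable B\<close> by blast
  have s: "s1 \<notin> B" "s2 \<notin> B" "s1 \<noteq> 0" "s2 \<noteq> 0" "s1 \<noteq> s2"
    using s1 s2 by auto
  define J where "J g = (\<integral>x. indicator {y. f y = 0 \<and> h y = 0} x * X x g \<partial>N)" for g
  have "J f + s * J h = 0" if "s \<notin> B" "s \<noteq> 0" for s
  proof -
    have fs: "(\<lambda>y. f y + s * h y) \<in> Cinf M"
      by (intro Cinf_add Cinf_mult Cinf_const f h)
    have X_eq: "X x (\<lambda>y. f y + s * h y) = X x f + s * X x h" for x
      using tangent_add[OF vfields_tangent[OF X] f Cinf_mult[OF Cinf_const h]]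
        tangent_cmult[OF vfields_tangent[OF X] h] by simp
    have "measure N (r -` {s} \<inter> space N) = 0"
      using that by (simp add: B_def measure_distr)
    then have "AE x in N. r x \<noteq> s"
      by (subst AE_iff_measurable[of "r -` {s} \<inter> space N"]) (auto simp: emeasure_eq_measure)
    then have *: "AE x in N. indicator {y. f y + s * h y = 0} x * X x (\<lambda>y. f y + s * h y)
        = (indicator {y. f y = 0 \<and> h y = 0} x * X x f + s * (indicator {y. f y = 0 \<and> h y = 0} x * X x h) :: real)"
    proof eventually_elim
      case (elim x)
      have "h x = 0" if "f x + s * h x = 0"
      proof (rule ccontr)
        assume "h x \<noteq> 0"
        moreover have "f x = - (s * h x)" using that by simp
        ultimately show False using elim by (simp add: r_def)
      qed
      then have "f x + s * h x = 0 \<longleftrightarrow> f x = 0 \<and> h x = 0" by auto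
      then show ?case by (simp add: X_eq indicator_def)
    qed
    have "0 = (\<integral>x. indicator {y. f y + s * h y = 0} x * X x (\<lambda>y. f y + s * h y) \<partial>N)"
      using integral_level_set_derivation[OF N X zero fs] by simp
    also have "\<dots> = (\<integral>x. indicator {y. f y = 0 \<and> h y = 0} x * X x f
        + s * (indicator {y. f y = 0 \<and> h y = 0} x * X x h) \<partial>N)"
      using * by (intro integral_cong_AE) (auto simp: X_eq)
    also have "\<dots> = J f + s * J h"
      unfolding J_def using int[THEN integrable_mult_indicator[OF Z]] by simp
    finally show ?thesis by simp
  qed
  then have "J f + s1 * J h = 0" "J f + s2 * J h = 0" using s by auto
  then have "(s1 - s2) * J h = 0" unfolding left_diff_distrib by linarith
  then have "J h = 0" using s by simp
  with \<open>J f + s1 * J h = 0\<close> show ?thesis by (simp add: J_def)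
qed

text \<open>No bump functions are needed: smooth functions, among them \<open>X f\<close>, are constant on the class of
  points that they do not separate from \<open>x\<close>, and this class is a countable intersection of level sets.\<close>

lemma derivation_vanishes_at_atom:
  assumes N: "finite_measure N" "sets N = sets borel"
    and X: "X \<in> vfields M" and zero: "\<And>f. f \<in> Cinf M \<Longrightarrow> (\<integral>x. X x f \<partial>N) = 0"
    and x: "measure N {x} > 0"
  shows "X x f = 0"
proof (cases "f \<in> Cinf M")
  case f: True
  interpret finite_measure N by fact
  have space: "space N = UNIV" using sets_eq_imp_space_eq[OF N(2)] by simp
  define Q where "Q h = {y. h y \<noteq> h x}" for h :: "'m \<Rightarrow> real"
  have Q: "open (Q h)" if "h \<in> Cinf M" for h
    unfolding Q_def by (intro open_Collect_neq Cinf_continuous[OF that] continuous_on_const)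
  \<comment> \<open>\<open>Q h\<close> consists of the points that \<open>h\<close> separates from
    \<open>x\<close>. By Lindelof, countably many \<open>h\<close> separate from \<open>x\<close>
    every point that any smooth function separates from it.\<close>
  obtain \<F> where \<F>: "\<F> \<subseteq> Q ` Cinf M" "countable \<F>" "\<Union>\<F> = \<Union>(Q ` Cinf M)"
    by (rule Lindelof[of "Q ` Cinf M"]) (use Q in auto)
  \<comment> \<open>The added member \<open>Q (\<lambda>y. 0)\<close> is the empty set: it leaves
    the union unchanged and makes the family nonempty, so that \<open>from_nat_into\<close>
    enumerates it.\<close>
  define A where "A = insert (Q (\<lambda>y. 0)) \<F>"
  have A: "A \<noteq> {}" "countable A" "A \<subseteq> Q ` Cinf M"
    using \<F>(1,2) Cinf_const by (auto simp: A_def)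
  have "\<exists>h. h \<in> Cinf M \<and> from_nat_into A n = Q h" for n
    using from_nat_into[OF A(1), of n] A(3) by blast
  then obtain h where h: "\<And>n. h n \<in> Cinf M" "\<And>n. from_nat_into A n = Q (h n)"
    by metis
  have "(\<Union>n. Q (h n)) = \<Union>A"
    using range_from_nat_into[OF A(1,2)] by (simp add: h(2))
  also have "\<dots> = \<Union>(Q ` Cinf M)"
    using \<F>(3) by (auto simp: A_def Q_def)
  finally have Qh: "(\<Union>n. Q (h n)) = \<Union>(Q ` Cinf M)" .
  define S where "S = {y. \<forall>n. h n y = h n x}"
  have S: "k y = k x" if "k \<in> Cinf M" "y \<in> S" for k y
    using that Qh by (auto simp: Q_def S_def set_eq_iff)
  define f' where "f' y = f y - f x" for y
  have f': "f' \<in> Cinf M" unfolding f'_def by (intro Cinf_diff Cinf_const f)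
  \<comment> \<open>A sum of squares packs the first \<open>n\<close> level conditions into one
    smooth function, so that the result on two functions applies to \<open>f'\<close> and
    \<open>H n\<close>; then \<open>n\<close> tends to infinity.\<close>
  define H where "H n y = (\<Sum>i<n. (h i y - h i x)\<^sup>2)" for n y
  have H: "H n \<in> Cinf M" for n
    unfolding H_def by (intro Cinf_sum Cinf_power Cinf_diff Cinf_const h)
  have H0: "H n y = 0 \<longleftrightarrow> (\<forall>i<n. h i y = h i x)" for n y
    by (auto simp: H_def sum_nonneg_eq_0_iff)
  have int: "integrable N (\<lambda>y. X y f')"
    by (rule Cinf_integrable[OF vfield_Cinf[OF X] N])
  have [measurable]: "f' \<in> borel_measurable N" "H n \<in> borel_measurable N" "h n \<in> borel_measurable N" for n
    using Cinf_integrable[OF _ N] f' h H by auto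
  have S_sets [measurable]: "S \<in> sets N"
  proof -
    have "S = (\<Inter>n. {y \<in> space N. h n y = h n x})" by (auto simp: S_def space)
    then show ?thesis by simp
  qed
  have "(\<lambda>n. \<integral>y. indicator {y. f' y = 0 \<and> H n y = 0} y * X y f' \<partial>N) \<longlonglongrightarrow> (\<integral>y. indicator S y * X y f' \<partial>N)"
  proof (rule integral_dominated_convergence[where w = "\<lambda>y. \<bar>X y f'\<bar>"])
    show "AE y in N. (\<lambda>n. indicator {y. f' y = 0 \<and> H n y = 0} y * X y f') \<longlonglongrightarrow> indicator S y * X y f'"
    proof (intro AE_I2 tendsto_intros)
      fix y
      show "(\<lambda>n. indicator {y. f' y = 0 \<and> H n y = 0} y :: real) \<longlonglongrightarrow> indicator S y"
      proof (cases "y \<in> S")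
        case True
        then have "f' y = 0" "H n y = 0" for n using S[OF f True] by (auto simp: f'_def H0 S_def)
        with True show ?thesis by simp
      next
        case False
        then obtain i where "h i y \<noteq> h i x" by (auto simp: S_def)
        then have "\<forall>n>i. indicator {y. f' y = 0 \<and> H n y = 0} y = (0 :: real)"
          by (auto simp: indicator_def H0)
        then have "\<forall>\<^sub>F n in sequentially. indicator {y. f' y = 0 \<and> H n y = 0} y = (0 :: real)"
          unfolding eventually_sequentially by (intro exI[of _ "Suc i"]) auto
        with False show ?thesis by (simp add: tendsto_eventually)
      qed
    qed
    show "AE y in N. norm (indicator {y. f' y = 0 \<and> H n y = 0} y * X y f') \<le> \<bar>X y f'\<bar>" for n
      by (auto simp: indicator_def)
    show "integrable N (\<lambda>y. \<bar>X y f'\<bar>)" using int by simp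
  qed (use int in auto)
  then have "(\<integral>y. indicator S y * X y f' \<partial>N) = 0"
    using integral_joint_level_set_derivation[OF N X zero f' H] by (simp add: LIMSEQ_const_iff)
  also have "(\<lambda>y. indicator S y * X y f') = (\<lambda>y. indicator S y * X x f')"
    using S[OF vfield_Cinf[OF X]] by (auto simp: fun_eq_iff indicator_def)
  finally have "measure N S * X x f' = 0"
    by (simp add: space)
  moreover have "measure N {x} \<le> measure N S"
    by (rule finite_measure_mono) (auto simp: S_def S_sets[unfolded S_def])
  moreover have "X x f' = X x f"
    unfolding f'_def using tangent_diff[OF vfields_tangent[OF X] f Cinf_const]
    by (simp add: tangent_const[OF vfields_tangent[OF X]])
  ultimately show ?thesis using x by auto
qed (rule tangent_nonsmooth[OF vfields_tangent[OF X]])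

lemma cyl_vfield_eq_0I:
  assumes W: "W \<in> cyl_vfields M" and zero: "\<And>f \<mu>. f \<in> Cinf M \<Longrightarrow> star (\<lambda>x. W \<mu> x f) \<mu> = 0"
  shows "W = 0"
proof (intro ext)
  fix \<mu> x f
  have "W (mix t x \<mu>) x f = 0" if t: "0 < t" "t < 1" for t
  proof (rule derivation_vanishes_at_atom[OF finite_measure_meas sets_meas cyl_vfield_at[OF W]])
    have "star (indicator {x}) (mix t x \<mu>) = (1 - t) * star (indicator {x}) \<mu> + t * indicator {x} x"
      using t by (intro star_mix[where C = 1]) auto
    moreover have "star (indicator {x}) \<nu> = measure (meas \<nu>) {x}" for \<nu> :: "'m prob_meas"
      by (simp add: star_def)
    ultimately show "measure (meas (mix t x \<mu>)) {x} > 0"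
      using t by (simp add: add_nonneg_pos)
  qed (use zero in \<open>simp add: star_def\<close>)
  then have "\<forall>\<^sub>F t in at_right 0. W (mix t x \<mu>) x f = 0"
    by (intro eventually_at_rightI[of 0 1]) auto
  then have "((\<lambda>t. W (mix t x \<mu>) x f) \<longlongrightarrow> 0) (at_right 0)"
    by (rule tendsto_eventually)
  \<comment> \<open>The component of \<open>W\<close> at \<open>x\<close> and \<open>f\<close> is a
    cylinder function, so its value at \<open>\<mu>\<close> is the limit of the values at the
    mixtures, where \<open>x\<close> is an atom.\<close>
  moreover have "((\<lambda>t. W (mix t x \<mu>) x f) \<longlongrightarrow> W \<mu> x f) (at_right 0)"
    by (rule cyl_fun_mix_tendsto[OF cyl_vfield_component[OF W]])
  ultimately show "W \<mu> x f = 0 \<mu> x f"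
    using tendsto_unique[of "at_right (0::real)"] by fastforce
qed

end

section \<open>The connection \<open>nabla_int\<close> and the bracket\<close>

text \<open>\<open>u \<otimes> w\<close> has the components \<open>\<mu> \<mapsto> u(\<mu>) w x \<phi>\<close>, so \<open>\<nabla>\<^sup>i\<^sup>n\<^sup>t\<close> lets \<open>V\<close> act on each component.\<close>

definition act_components ::
  "'m::topological_space manifold \<Rightarrow> 'm cvfield \<Rightarrow> 'm cvfield \<Rightarrow> 'm cvfield" where
  "act_components M V Z = (\<lambda>\<mu> x \<phi>. act M V (\<lambda>\<nu>. Z \<nu> x \<phi>) \<mu>)"

text \<open>The common shape of \<open>nab\<close> and \<open>lie_bracket\<close>. Linearity over
  real constants is the right notion here, because for fixed \<open>\<mu>\<close> the coefficients
  of a cylinder field are real numbers.\<close>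

definition bilinear_vfields ::
  "'m::topological_space manifold \<Rightarrow> ('m vfield \<Rightarrow> 'm vfield \<Rightarrow> 'm vfield) \<Rightarrow> bool" where
  "bilinear_vfields M b \<longleftrightarrow> (\<forall>X\<in>vfields M. \<forall>Y\<in>vfields M. b X Y \<in> vfields M \<and>
     (\<forall>Z\<in>vfields M. b (X + Z) Y = b X Y + b Z Y \<and> b X (Y + Z) = b X Y + b X Z) \<and>
     (\<forall>c. b (\<lambda>x \<phi>. c * X x \<phi>) Y = (\<lambda>x \<phi>. c * b X Y x \<phi>) \<and>
          b X (\<lambda>x \<phi>. c * Y x \<phi>) = (\<lambda>x \<phi>. c * b X Y x \<phi>)))"

definition lift2 :: "('m vfield \<Rightarrow> 'm vfield \<Rightarrow> 'm vfield) \<Rightarrow>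
    'm::topological_space cvfield \<Rightarrow> 'm cvfield \<Rightarrow> 'm cvfield" where
  "lift2 b X Y = (\<lambda>\<mu>. b (X \<mu>) (Y \<mu>))"

context closed_manifold
begin

lemma act_components_add:
  assumes "V \<in> cyl_vfields M" "Y \<in> cyl_vfields M" "Z \<in> cyl_vfields M"
  shows "act_components M V (Y + Z) = act_components M V Y + act_components M V Z"
  by (intro ext) (simp add: act_components_def act_add[OF assms(1)] cyl_vfield_component assms(2,3))

lemma act_components_cmult:
  assumes "V \<in> cyl_vfields M" "Z \<in> cyl_vfields M"
  shows "act_components M V (\<lambda>\<mu> x \<phi>. c * Z \<mu> x \<phi>) = (\<lambda>\<mu> x \<phi>. c * act_components M V Z \<mu> x \<phi>)"
  by (intro ext) (simp add: act_components_def act_cmult[OF assms(1)] cyl_vfield_component assms(2))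

lemma act_components_diff:
  assumes "V \<in> cyl_vfields M" "Y \<in> cyl_vfields M" "Z \<in> cyl_vfields M"
  shows "act_components M V (Y - Z) = act_components M V Y - act_components M V Z"
  using act_components_add[OF assms(1) cyl_vfields_diff[OF assms(2,3)] assms(3)] by simp

lemma act_components_zero: "V \<in> cyl_vfields M \<Longrightarrow> act_components M V 0 = 0"
  by (intro ext) (simp add: act_components_def act_const)

lemma act_components_tensor:
  assumes "V \<in> cyl_vfields M" "u \<in> cyl_funs M"
  shows "act_components M V (tensor u w) = tensor (act M V u) w"
  by (intro ext)
    (simp add: act_components_def tensor_def act_mult[OF assms] cyl_funs_const act_const[OF assms(1)])

lemma act_components_cyl_vfields:
  assumes V: "V \<in> cyl_vfields M" and Z: "Z \<in> cyl_vfields M"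
  shows "act_components M V Z \<in> cyl_vfields M"
  using Z
proof (induction Z rule: cyl_vfields_induct)
  case zero
  show "act_components M V 0 \<in> cyl_vfields M"
    unfolding act_components_zero[OF V] by (rule cyl_vfields_zero)
next
  case (step Z u w)
  show "act_components M V (Z + tensor u w) \<in> cyl_vfields M"
    unfolding act_components_add[OF V step(1) tensor_cyl_vfields[OF step(2,3)]]
      act_components_tensor[OF V step(2)]
    by (intro cyl_vfields_add_tensor step act_cyl_funs V)
qed

text \<open>\<open>act_components\<close> refers to no tensor representation, so it is well defined
  from the start and meets the requirements. Additivity and the values on pure tensors leave no
  other candidate, by induction on the field.\<close>

lemma nabla_int_eq:
  assumes V: "V \<in> cyl_vfields M" and Z: "Z \<in> cyl_vfields M"
  shows "nabla_int M V Z = act_components M V Z"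
proof -
  let ?P = "\<lambda>T. T \<in> extensional (cyl_vfields M) \<and>
     (\<forall>Y\<in>cyl_vfields M. \<forall>Z\<in>cyl_vfields M. T (Y + Z) = T Y + T Z) \<and>
     (\<forall>Z\<in>cyl_vfields M. \<forall>c. T (\<lambda>\<mu> x \<phi>. c * Z \<mu> x \<phi>) = (\<lambda>\<mu> x \<phi>. c * T Z \<mu> x \<phi>)) \<and>
     (\<forall>u\<in>cyl_funs M. \<forall>w\<in>vfields M. T (tensor u w) = tensor (act M V u) w)"
  \<comment> \<open>The description asks for an extensional map, hence the restriction.\<close>
  let ?T = "restrict (act_components M V) (cyl_vfields M)"
  have "nabla_int M V = ?T"
    unfolding nabla_int_def
  proof (rule the_equality)
    show "?P ?T"
      using V by (simp add: cyl_vfields_add cyl_vfields_cmult tensor_cyl_vfields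
          act_components_add act_components_cmult act_components_tensor)
  next
    fix T assume T: "?P T"
    have "T Z = act_components M V Z" if "Z \<in> cyl_vfields M" for Z
      using that
    proof (induction Z rule: cyl_vfields_induct)
      case zero
      have "T (0 + 0) = T 0 + T 0" using T cyl_vfields_zero by blast
      then have "T 0 = 0" by (simp only: add_0_right add_cancel_right_right)
      then show "T 0 = act_components M V 0" by (simp only: act_components_zero[OF V])
    next
      case (step Z u w)
      have tn: "tensor u w \<in> cyl_vfields M" by (rule tensor_cyl_vfields[OF step(2,3)])
      have "T (Z + tensor u w) = T Z + T (tensor u w)" using T step(1) tn by blast
      moreover have "T (tensor u w) = tensor (act M V u) w" using T step(2,3) by blast
      ultimately show "T (Z + tensor u w) = act_components M V (Z + tensor u w)"
        by (simp only: step.IH act_components_add[OF V step(1) tn] act_components_tensor[OF V step(2)])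
    qed
    then show "T = ?T"
      using T by (intro extensionalityI[of _ "cyl_vfields M"]) auto
  qed
  then show ?thesis using Z by simp
qed

section \<open>Pointwise lifts of bilinear operations\<close>

lemma bilinear_vfields_mem: "bilinear_vfields M b \<Longrightarrow> X \<in> vfields M \<Longrightarrow> Y \<in> vfields M \<Longrightarrow> b X Y \<in> vfields M"
  and bilinear_vfields_add1: "bilinear_vfields M b \<Longrightarrow> X \<in> vfields M \<Longrightarrow> Z \<in> vfields M \<Longrightarrow> Y \<in> vfields M \<Longrightarrow>
    b (X + Z) Y = b X Y + b Z Y"
  and bilinear_vfields_add2: "bilinear_vfields M b \<Longrightarrow> X \<in> vfields M \<Longrightarrow> Y \<in> vfields M \<Longrightarrow> Z \<in> vfields M \<Longrightarrow>
    b X (Y + Z) = b X Y + b X Z"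
  and bilinear_vfields_cmult1: "bilinear_vfields M b \<Longrightarrow> X \<in> vfields M \<Longrightarrow> Y \<in> vfields M \<Longrightarrow>
    b (\<lambda>x \<phi>. c * X x \<phi>) Y = (\<lambda>x \<phi>. c * b X Y x \<phi>)"
  and bilinear_vfields_cmult2: "bilinear_vfields M b \<Longrightarrow> X \<in> vfields M \<Longrightarrow> Y \<in> vfields M \<Longrightarrow>
    b X (\<lambda>x \<phi>. c * Y x \<phi>) = (\<lambda>x \<phi>. c * b X Y x \<phi>)"
  unfolding bilinear_vfields_def by blast+

lemma bilinear_vfields_zero:
  assumes b: "bilinear_vfields M b" and X: "X \<in> vfields M"
  shows "b 0 X = 0" "b X 0 = 0"
proof -
  have "b (0 + 0) X = b 0 X + b 0 X" "b X (0 + 0) = b X 0 + b X 0"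
    by (rule bilinear_vfields_add1[OF b vfields_zero vfields_zero X],
        rule bilinear_vfields_add2[OF b X vfields_zero vfields_zero])
  then show "b 0 X = 0" "b X 0 = 0"
    by (simp_all only: add_0_right add_cancel_right_right)
qed

lemma lift2_zero:
  assumes b: "bilinear_vfields M b" and Y: "Y \<in> cyl_vfields M"
  shows "lift2 b 0 Y = 0" "lift2 b Y 0 = 0"
  by (simp_all only: lift2_def zero_fun_apply bilinear_vfields_zero[OF b cyl_vfield_at[OF Y]])
    (simp_all add: fun_eq_iff)

lemma lift2_add1:
  assumes b: "bilinear_vfields M b" and "X \<in> cyl_vfields M" "Z \<in> cyl_vfields M" "Y \<in> cyl_vfields M"
  shows "lift2 b (X + Z) Y = lift2 b X Y + lift2 b Z Y"
proof (rule ext)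
  fix \<mu>
  have "b ((X + Z) \<mu>) (Y \<mu>) = b (X \<mu>) (Y \<mu>) + b (Z \<mu>) (Y \<mu>)"
    using bilinear_vfields_add1[OF b cyl_vfield_at[OF assms(2)] cyl_vfield_at[OF assms(3)] cyl_vfield_at[OF assms(4)]]
    by (simp only: plus_fun_apply)
  then show "lift2 b (X + Z) Y \<mu> = (lift2 b X Y + lift2 b Z Y) \<mu>"
    by (simp only: lift2_def plus_fun_apply)
qed

lemma lift2_add2:
  assumes b: "bilinear_vfields M b" and "X \<in> cyl_vfields M" "Y \<in> cyl_vfields M" "Z \<in> cyl_vfields M"
  shows "lift2 b X (Y + Z) = lift2 b X Y + lift2 b X Z"
proof (rule ext)
  fix \<mu>
  have "b (X \<mu>) ((Y + Z) \<mu>) = b (X \<mu>) (Y \<mu>) + b (X \<mu>) (Z \<mu>)"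
    using bilinear_vfields_add2[OF b cyl_vfield_at[OF assms(2)] cyl_vfield_at[OF assms(3)] cyl_vfield_at[OF assms(4)]]
    by (simp only: plus_fun_apply)
  then show "lift2 b X (Y + Z) \<mu> = (lift2 b X Y + lift2 b X Z) \<mu>"
    by (simp only: lift2_def plus_fun_apply)
qed

lemma lift2_tensor:
  assumes b: "bilinear_vfields M b" and w: "w \<in> vfields M" and z: "z \<in> vfields M"
  shows "lift2 b (tensor u w) (tensor v z) = tensor (\<lambda>\<mu>. u \<mu> * v \<mu>) (b w z)"
  using bilinear_vfields_cmult1[OF b w] bilinear_vfields_cmult2[OF b w z] vfields_cmult[OF z]
  by (simp add: lift2_def tensor_def mult.assoc)

text \<open>On pure tensors the lift is \<open>tensor\<close> of the product of coefficients with
  \<open>b w z\<close>, so the claim is the product rule for \<open>act\<close>; additivity in each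
  argument does the rest. Membership and the identity are proved together because the additive step
  uses that both summands are cylinder fields.\<close>

lemma lift2_act_components:
  assumes b: "bilinear_vfields M b" and V: "V \<in> cyl_vfields M"
    and X: "X \<in> cyl_vfields M" and Y: "Y \<in> cyl_vfields M"
  shows "lift2 b X Y \<in> cyl_vfields M \<and> act_components M V (lift2 b X Y)
    = lift2 b (act_components M V X) Y + lift2 b X (act_components M V Y)"
proof -
  define P where "P X Y \<longleftrightarrow> lift2 b X Y \<in> cyl_vfields M \<and> act_components M V (lift2 b X Y)
      = lift2 b (act_components M V X) Y + lift2 b X (act_components M V Y)" for X Y
  let ?A = "\<lambda>X Y. lift2 b X Y \<in> cyl_vfields M"
    and ?B = "\<lambda>X Y. act_components M V (lift2 b X Y)
      = lift2 b (act_components M V X) Y + lift2 b X (act_components M V Y)"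
  \<comment> \<open>The inner induction runs over the second argument while the first is a pure
    tensor; the outer one then runs over the first argument.\<close>
  have tensor: "P (tensor u w) Y" if u: "u \<in> cyl_funs M" and w: "w \<in> vfields M" for u w
    using Y
  proof (induction Y rule: cyl_vfields_induct)
    case zero
    have uw: "tensor u w \<in> cyl_vfields M" by (rule tensor_cyl_vfields[OF u w])
    show "P (tensor u w) 0"
      unfolding P_def
      by (simp only: lift2_zero[OF b] act_components_zero V uw act_components_cyl_vfields
          cyl_vfields_zero add_0_right simp_thms)
  next
    case (step Y v z)
    have IH: "?A (tensor u w) Y" "?B (tensor u w) Y" using step.IH by (simp_all only: P_def)
    have uw: "tensor u w \<in> cyl_vfields M" by (rule tensor_cyl_vfields[OF u w])
    have vz: "tensor v z \<in> cyl_vfields M" by (rule tensor_cyl_vfields[OF step(2,3)])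
    have bwz: "b w z \<in> vfields M" using bilinear_vfields_mem[OF b w] step by blast
    have uv: "(\<lambda>\<mu>. u \<mu> * v \<mu>) \<in> cyl_funs M" using cyl_funs_mult u step by blast
    have 1: "lift2 b (tensor u w) (tensor v z) = tensor (\<lambda>\<mu>. u \<mu> * v \<mu>) (b w z)"
      using lift2_tensor[OF b w] step by blast
    have 2: "lift2 b (tensor (act M V u) w) (tensor v z) = tensor (\<lambda>\<mu>. act M V u \<mu> * v \<mu>) (b w z)"
      "lift2 b (tensor u w) (tensor (act M V v) z) = tensor (\<lambda>\<mu>. u \<mu> * act M V v \<mu>) (b w z)"
      using lift2_tensor[OF b w] step by blast+
    have A: "?A (tensor u w) (tensor v z)"
      unfolding 1 by (rule tensor_cyl_vfields[OF uv bwz])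
    have B: "?B (tensor u w) (tensor v z)"
      unfolding act_components_tensor[OF V u] act_components_tensor[OF V step(2)] 2
      unfolding 1 act_components_tensor[OF V uv]
      by (simp add: tensor_def fun_eq_iff act_mult[OF V u step(2)] algebra_simps)
    have eq: "lift2 b (tensor u w) (Y + tensor v z) = lift2 b (tensor u w) Y + lift2 b (tensor u w) (tensor v z)"
      by (rule lift2_add2[OF b uw step(1) vz])
    have "?A (tensor u w) (Y + tensor v z)"
      unfolding eq using IH A cyl_vfields_add by blast
    moreover have "?B (tensor u w) (Y + tensor v z)"
    proof -
      have "act_components M V (lift2 b (tensor u w) (Y + tensor v z))
          = act_components M V (lift2 b (tensor u w) Y) + act_components M V (lift2 b (tensor u w) (tensor v z))"
        unfolding eq using IH A by (intro act_components_add V) auto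
      also have "\<dots> = (lift2 b (act_components M V (tensor u w)) Y + lift2 b (act_components M V (tensor u w)) (tensor v z))
          + (lift2 b (tensor u w) (act_components M V Y) + lift2 b (tensor u w) (act_components M V (tensor v z)))"
        using IH B by (simp only: add_ac)
      also have "\<dots> = lift2 b (act_components M V (tensor u w)) (Y + tensor v z)
          + lift2 b (tensor u w) (act_components M V (Y + tensor v z))"
        by (simp only: act_components_add[OF V step(1) vz] lift2_add2[OF b] act_components_cyl_vfields V uw step(1) vz)
      finally show ?thesis .
    qed
    ultimately show "P (tensor u w) (Y + tensor v z)" by (simp only: P_def simp_thms)
  qed
  have "P X Y"
    using X
  proof (induction X rule: cyl_vfields_induct)
    case zero
    show "P 0 Y"
      unfolding P_def
      by (simp only: lift2_zero[OF b] act_components_zero V Y act_components_cyl_vfields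
          cyl_vfields_zero add_0_right simp_thms)
  next
    case (step X u w)
    have uw: "tensor u w \<in> cyl_vfields M" by (rule tensor_cyl_vfields[OF step(2,3)])
    have *: "?A X Y" "?B X Y" "?A (tensor u w) Y" "?B (tensor u w) Y"
      using step.IH tensor[OF step(2,3)] by (simp_all only: P_def)
    have eq: "lift2 b (X + tensor u w) Y = lift2 b X Y + lift2 b (tensor u w) Y"
      by (rule lift2_add1[OF b step(1) uw Y])
    have "?A (X + tensor u w) Y"
      unfolding eq using * cyl_vfields_add by blast
    moreover have "?B (X + tensor u w) Y"
    proof -
      have "act_components M V (lift2 b (X + tensor u w) Y)
          = act_components M V (lift2 b X Y) + act_components M V (lift2 b (tensor u w) Y)"
        unfolding eq using * by (intro act_components_add V) auto
      also have "\<dots> = (lift2 b (act_components M V X) Y + lift2 b (act_components M V (tensor u w)) Y)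
          + (lift2 b X (act_components M V Y) + lift2 b (tensor u w) (act_components M V Y))"
        using * by (simp only: add_ac)
      also have "\<dots> = lift2 b (act_components M V (X + tensor u w)) Y
          + lift2 b (X + tensor u w) (act_components M V Y)"
        by (simp only: act_components_add[OF V step(1) uw] lift2_add1[OF b] act_components_cyl_vfields V uw step(1) Y)
      finally show ?thesis .
    qed
    ultimately show "P (X + tensor u w) Y" by (simp only: P_def simp_thms)
  qed
  then show ?thesis by (simp only: P_def)
qed

lemma lift2_cyl_vfields:
  "bilinear_vfields M b \<Longrightarrow> X \<in> cyl_vfields M \<Longrightarrow> Y \<in> cyl_vfields M \<Longrightarrow> lift2 b X Y \<in> cyl_vfields M"
  using lift2_act_components[OF _ cyl_vfields_zero] by blast

lemma act_components_lift2:
  "bilinear_vfields M b \<Longrightarrow> V \<in> cyl_vfields M \<Longrightarrow> X \<in> cyl_vfields M \<Longrightarrow> Y \<in> cyl_vfields M \<Longrightarrow>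
    act_components M V (lift2 b X Y)
      = lift2 b (act_components M V X) Y + lift2 b X (act_components M V Y)"
  using lift2_act_components by blast

lemma lift2_diff1:
  assumes "bilinear_vfields M b" "X \<in> cyl_vfields M" "Z \<in> cyl_vfields M" "Y \<in> cyl_vfields M"
  shows "lift2 b (X - Z) Y = lift2 b X Y - lift2 b Z Y"
  using lift2_add1[OF assms(1) cyl_vfields_diff[OF assms(2,3)] assms(3,4)]
  by (simp only: diff_add_cancel add_diff_cancel_right')

lemma lift2_diff2:
  assumes "bilinear_vfields M b" "X \<in> cyl_vfields M" "Y \<in> cyl_vfields M" "Z \<in> cyl_vfields M"
  shows "lift2 b X (Y - Z) = lift2 b X Y - lift2 b X Z"
  using lift2_add2[OF assms(1,2) cyl_vfields_diff[OF assms(3,4)] assms(4)]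
  by (simp only: diff_add_cancel add_diff_cancel_right')

lemma act_components_vfield_diff:
  assumes "X \<in> cyl_vfields M" "Y \<in> cyl_vfields M" "Z \<in> cyl_vfields M"
  shows "act_components M (X - Y) Z = act_components M X Z - act_components M Y Z"
  by (intro ext) (simp add: act_components_def act_diff_vfield[OF assms(1,2) cyl_vfield_component[OF assms(3)]])

section \<open>The Lie bracket on the manifold\<close>

lemma lie_bracket_vfields:
  assumes X: "X \<in> vfields M" and Y: "Y \<in> vfields M"
  shows "lie_bracket X Y \<in> vfields M"
proof -
  note Xt = vfields_tangent[OF X] and Yt = vfields_tangent[OF Y]
  note Xs = dir_deriv_Cinf[OF X] and Ys = dir_deriv_Cinf[OF Y]
  have add: "dir_deriv Z (\<lambda>y. f y + h y) = (\<lambda>x. dir_deriv Z f x + dir_deriv Z h x)"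
    and cm: "dir_deriv Z (\<lambda>y. c * f y) = (\<lambda>x. c * dir_deriv Z f x)"
    and mult: "dir_deriv Z (\<lambda>y. f y * h y) = (\<lambda>x. f x * dir_deriv Z h x + h x * dir_deriv Z f x)"
    if "Z \<in> vfields M" "f \<in> Cinf M" "h \<in> Cinf M" for Z f h c
    by (simp_all add: dir_deriv_def tangent_add[OF vfields_tangent[OF that(1)] that(2,3)]
        tangent_cmult[OF vfields_tangent[OF that(1)] that(2)]
        tangent_mult[OF vfields_tangent[OF that(1)] that(2,3)])
  have ns: "dir_deriv Z f = (\<lambda>x. 0)" if "Z \<in> vfields M" "f \<notin> Cinf M" for Z f
    using tangent_nonsmooth[OF vfields_tangent[OF that(1)] that(2)] by (auto simp: dir_deriv_def)
  have "lie_bracket X Y x \<in> tangent_space M x" for x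
    unfolding tangent_space_def
  proof (intro CollectI conjI ballI allI impI)
    fix f h c assume f: "f \<in> Cinf M" 
    show "lie_bracket X Y x (\<lambda>y. c * f y) = c * lie_bracket X Y x f"
      by (simp add: lie_bracket_def cm[OF X f f] cm[OF Y f f] tangent_cmult[OF Xt Ys] tangent_cmult[OF Yt Xs]
          algebra_simps)
    assume h: "h \<in> Cinf M"
    show "lie_bracket X Y x (\<lambda>y. f y + h y) = lie_bracket X Y x f + lie_bracket X Y x h"
      by (simp add: lie_bracket_def add[OF X f h] add[OF Y f h] tangent_add[OF Xt Ys Ys] tangent_add[OF Yt Xs Xs])
    \<comment> \<open>Both iterated Leibniz expansions contain the same cross products of first
      derivatives of \<open>f\<close> and \<open>h\<close>; they cancel in the commutator.\<close>
    have "X x (\<lambda>x. f x * dir_deriv Y h x + h x * dir_deriv Y f x)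
        = (f x * X x (dir_deriv Y h) + dir_deriv Y h x * X x f) + (h x * X x (dir_deriv Y f) + dir_deriv Y f x * X x h)"
      using f h Ys by (simp add: tangent_add[OF Xt] tangent_mult[OF Xt] Cinf_mult)
    moreover have "Y x (\<lambda>x. f x * dir_deriv X h x + h x * dir_deriv X f x)
        = (f x * Y x (dir_deriv X h) + dir_deriv X h x * Y x f) + (h x * Y x (dir_deriv X f) + dir_deriv X f x * Y x h)"
      using f h Xs by (simp add: tangent_add[OF Yt] tangent_mult[OF Yt] Cinf_mult)
    ultimately show "lie_bracket X Y x (\<lambda>y. f y * h y) = f x * lie_bracket X Y x h + h x * lie_bracket X Y x f"
      unfolding lie_bracket_def mult[OF X f h] mult[OF Y f h] by (simp add: dir_deriv_def algebra_simps)
  next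
    fix f assume f: "f \<notin> Cinf M"
    show "lie_bracket X Y x f = 0"
      by (simp add: lie_bracket_def ns[OF X f] ns[OF Y f] tangent_const[OF Xt] tangent_const[OF Yt])
  qed
  moreover have "dir_deriv (lie_bracket X Y) f \<in> Cinf M" for f
  proof -
    have "dir_deriv (lie_bracket X Y) f = (\<lambda>x. X x (dir_deriv Y f) - Y x (dir_deriv X f))"
      by (rule ext) (simp only: dir_deriv_def lie_bracket_def)
    then show ?thesis by (simp only: Cinf_diff vfield_Cinf X Y)
  qed
  ultimately show ?thesis by (simp add: vfields_def)
qed

lemma dir_deriv_add: "dir_deriv (X + Y) f = (\<lambda>x. dir_deriv X f x + dir_deriv Y f x)"
  and dir_deriv_cmult: "dir_deriv (\<lambda>x \<phi>. c * X x \<phi>) f = (\<lambda>x. c * dir_deriv X f x)"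
  by (simp_all add: dir_deriv_def)

lemma bilinear_lie_bracket: "bilinear_vfields M lie_bracket"
  unfolding bilinear_vfields_def
  by (intro ballI conjI allI lie_bracket_vfields)
    (simp_all add: lie_bracket_def fun_eq_iff dir_deriv_add dir_deriv_cmult algebra_simps
      tangent_add[OF vfields_tangent] tangent_cmult[OF vfields_tangent] dir_deriv_Cinf)

text \<open>Differentiating an integral of \<open>Z \<mu> x f\<close> over \<open>\<mu>\<close> hits
  two places: the coefficients of \<open>Z\<close> give the term with \<open>act_components\<close>,
  the integrating measure gives the derivative of \<open>dir_deriv (Z \<mu>) f\<close> along
  \<open>V\<close>.\<close>

lemma act_star_cyl_vfield:
  assumes V: "V \<in> cyl_vfields M" and Z: "Z \<in> cyl_vfields M" and f: "f \<in> Cinf M"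
  shows "act M V (\<lambda>\<mu>. star (\<lambda>x. Z \<mu> x f) \<mu>) \<mu>
    = star (\<lambda>x. act_components M V Z \<mu> x f) \<mu> + star (\<lambda>x. V \<mu> x (dir_deriv (Z \<mu>) f)) \<mu>"
  using Z
proof (induction Z rule: cyl_vfields_induct)
  case zero
  have 0: "dir_deriv ((0 :: 'm cvfield) \<mu>) f = (\<lambda>x. 0)" by (simp add: dir_deriv_def)
  show "act M V (\<lambda>\<mu>. star (\<lambda>x. 0 \<mu> x f) \<mu>) \<mu>
      = star (\<lambda>x. act_components M V 0 \<mu> x f) \<mu> + star (\<lambda>x. V \<mu> x (dir_deriv (0 \<mu>) f)) \<mu>"
    unfolding 0 act_components_zero[OF V]
    by (simp add: act_const V tangent_const[OF vfields_tangent[OF cyl_vfield_at[OF V]]])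
next
  case (step Z u w)
  note sm = vfield_Cinf[OF cyl_vfield_at[OF step(1)]] vfield_Cinf[OF cyl_vfield_at[OF V]] vfield_Cinf[OF step(3)]
  have DZ: "act_components M V Z \<mu> \<in> vfields M"
    by (intro cyl_vfield_at act_components_cyl_vfields V step)
  have eq: "star (\<lambda>x. (Z + tensor u w) \<mu> x f) \<mu> = star (\<lambda>x. Z \<mu> x f) \<mu> + u \<mu> * star (dir_deriv w f) \<mu>" for \<mu>
    using sm by (simp add: tensor_def star_add star_cmult Cinf_mult Cinf_const dir_deriv_def)
  have "act M V (\<lambda>\<mu>. star (\<lambda>x. (Z + tensor u w) \<mu> x f) \<mu>) \<mu>
      = act M V (\<lambda>\<mu>. star (\<lambda>x. Z \<mu> x f) \<mu>) \<mu> + act M V (\<lambda>\<mu>. u \<mu> * star (dir_deriv w f) \<mu>) \<mu>"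
    unfolding eq
    by (intro act_add V star_cyl_vfield step cyl_funs_mult cyl_funs_star dir_deriv_Cinf)
  also have "act M V (\<lambda>\<mu>. u \<mu> * star (dir_deriv w f) \<mu>) \<mu>
      = act M V u \<mu> * star (dir_deriv w f) \<mu> + u \<mu> * star (\<lambda>x. V \<mu> x (dir_deriv w f)) \<mu>"
    using step by (simp add: act_mult[OF V] cyl_funs_star dir_deriv_Cinf act_star[OF V])
  finally have "act M V (\<lambda>\<mu>. star (\<lambda>x. (Z + tensor u w) \<mu> x f) \<mu>) \<mu>
      = (star (\<lambda>x. act_components M V Z \<mu> x f) \<mu> + act M V u \<mu> * star (dir_deriv w f) \<mu>)
        + (star (\<lambda>x. V \<mu> x (dir_deriv (Z \<mu>) f)) \<mu> + u \<mu> * star (\<lambda>x. V \<mu> x (dir_deriv w f)) \<mu>)"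
    using step.IH by simp
  also have "star (\<lambda>x. act_components M V Z \<mu> x f) \<mu> + act M V u \<mu> * star (dir_deriv w f) \<mu>
      = star (\<lambda>x. act_components M V (Z + tensor u w) \<mu> x f) \<mu>"
    unfolding act_components_add[OF V step(1) tensor_cyl_vfields[OF step(2,3)]]
      act_components_tensor[OF V step(2)]
    using sm vfield_Cinf[OF DZ] by (simp add: tensor_def star_add star_cmult Cinf_mult Cinf_const dir_deriv_def)
  also have "star (\<lambda>x. V \<mu> x (dir_deriv (Z \<mu>) f)) \<mu> + u \<mu> * star (\<lambda>x. V \<mu> x (dir_deriv w f)) \<mu>
      = star (\<lambda>x. V \<mu> x (dir_deriv ((Z + tensor u w) \<mu>) f)) \<mu>"
  proof -
    have "dir_deriv ((Z + tensor u w) \<mu>) f = (\<lambda>x. dir_deriv (Z \<mu>) f x + u \<mu> * dir_deriv w f x)"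
      by (simp add: dir_deriv_def tensor_def)
    then have "V \<mu> x (dir_deriv ((Z + tensor u w) \<mu>) f)
        = V \<mu> x (dir_deriv (Z \<mu>) f) + u \<mu> * V \<mu> x (dir_deriv w f)" for x
      using tangent_add[OF vfields_tangent[OF cyl_vfield_at[OF V]]]
        tangent_cmult[OF vfields_tangent[OF cyl_vfield_at[OF V]]]
        dir_deriv_Cinf[OF cyl_vfield_at[OF step(1)]] dir_deriv_Cinf[OF step(3)]
      by (simp add: Cinf_mult Cinf_const)
    then show ?thesis
      using sm by (simp add: star_add star_cmult Cinf_mult Cinf_const)
  qed
  finally show ?case .
qed

text \<open>The double sum collects the second derivatives of \<open>F\<close>; the other sum is of
  first order in \<open>F\<close>. Only the first-order part distinguishes the two orders of
  applying \<open>V\<close> and \<open>Z\<close>.\<close>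

lemma act_act:
  assumes V: "V \<in> cyl_vfields M" and Z: "Z \<in> cyl_vfields M" and u: "cyl_rep M u k F f"
  shows "act M V (act M Z u) \<mu>
    = (\<Sum>i<k. \<Sum>j<k. partial j (partial i F) (stars k f \<mu>) * star (\<lambda>x. V \<mu> x (f j)) \<mu> * star (\<lambda>x. Z \<mu> x (f i)) \<mu>)
    + (\<Sum>i<k. partial i F (stars k f \<mu>) * (star (\<lambda>x. act_components M V Z \<mu> x (f i)) \<mu>
        + star (\<lambda>x. V \<mu> x (dir_deriv (Z \<mu>) (f i))) \<mu>))"
proof -
  have f: "f i \<in> Cinf M" if "i < k" for i using u that by (simp add: cyl_rep_def)
  have "act M Z u = (\<lambda>\<mu>. \<Sum>i<k. partial i F (stars k f \<mu>) * star (\<lambda>x. Z \<mu> x (f i)) \<mu>)"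
    by (rule ext) (rule act_eq[OF u cyl_vfield_at[OF Z]])
  then have "act M V (act M Z u) \<mu>
      = (\<Sum>i<k. act M V (\<lambda>\<mu>. partial i F (stars k f \<mu>) * star (\<lambda>x. Z \<mu> x (f i)) \<mu>) \<mu>)"
    by (simp add: act_sum[OF V] cyl_funs_mult cyl_funs_partial[OF u] star_cyl_vfield[OF Z])
  also have "\<dots> = (\<Sum>i<k. (\<Sum>j<k. partial j (partial i F) (stars k f \<mu>) * star (\<lambda>x. V \<mu> x (f j)) \<mu>) * star (\<lambda>x. Z \<mu> x (f i)) \<mu>
      + partial i F (stars k f \<mu>) * (star (\<lambda>x. act_components M V Z \<mu> x (f i)) \<mu>
        + star (\<lambda>x. V \<mu> x (dir_deriv (Z \<mu>) (f i))) \<mu>))"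
  proof (rule sum.cong)
    fix i assume "i \<in> {..<k}"
    then have i: "i < k" by simp
    show "act M V (\<lambda>\<mu>. partial i F (stars k f \<mu>) * star (\<lambda>x. Z \<mu> x (f i)) \<mu>) \<mu>
      = (\<Sum>j<k. partial j (partial i F) (stars k f \<mu>) * star (\<lambda>x. V \<mu> x (f j)) \<mu>) * star (\<lambda>x. Z \<mu> x (f i)) \<mu>
      + partial i F (stars k f \<mu>) * (star (\<lambda>x. act_components M V Z \<mu> x (f i)) \<mu>
        + star (\<lambda>x. V \<mu> x (dir_deriv (Z \<mu>) (f i))) \<mu>)"
      unfolding act_mult[OF V cyl_funs_partial[OF u i] star_cyl_vfield[OF Z]]
        act_eq[OF cyl_rep_partial[OF u i] cyl_vfield_at[OF V]] act_star_cyl_vfield[OF V Z f[OF i]] ..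
  qed simp
  finally show ?thesis
    by (simp only: sum.distrib sum_distrib_right)
qed

text \<open>Swapping the summations and using \<open>partial_commute\<close> identifies the
  second-order parts of the two iterated actions. The first-order parts assemble to the action of
  the explicit field, which is a cylinder field and hence the value of the description.\<close>

lemma bracket_eq:
  assumes V: "V \<in> cyl_vfields M" and Z: "Z \<in> cyl_vfields M"
  shows "bracket M V Z = lift2 lie_bracket V Z + act_components M V Z - act_components M Z V"
    and "u \<in> cyl_funs M \<Longrightarrow> act M (bracket M V Z) u \<mu> = act M V (act M Z u) \<mu> - act M Z (act M V u) \<mu>"
proof -
  define W where "W = lift2 lie_bracket V Z + act_components M V Z - act_components M Z V"
  have W: "W \<in> cyl_vfields M"
    unfolding W_def
    by (intro cyl_vfields_diff cyl_vfields_add lift2_cyl_vfields bilinear_lie_bracket act_components_cyl_vfields V Z)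
  have act_W: "act M W u \<mu> = act M V (act M Z u) \<mu> - act M Z (act M V u) \<mu>" if "u \<in> cyl_funs M" for u \<mu>
  proof -
    from that obtain k F f where u: "cyl_rep M u k F f" by (auto simp: cyl_funs_def)
    let ?p = "\<lambda>i. partial i F (stars k f \<mu>)"
    let ?q = "\<lambda>i j. partial i (partial j F) (stars k f \<mu>)"
    let ?s = "\<lambda>V i. star (\<lambda>x. V \<mu> x (f i)) \<mu>"
    have "(\<Sum>i<k. \<Sum>j<k. ?q j i * ?s V j * ?s Z i) = (\<Sum>i<k. \<Sum>j<k. ?q i j * ?s V i * ?s Z j)"
      by (rule sum.swap)
    also have "\<dots> = (\<Sum>i<k. \<Sum>j<k. ?q j i * ?s Z j * ?s V i)"
    proof (intro sum.cong refl)
      fix i j assume "i \<in> {..<k}" "j \<in> {..<k}"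
      then have "?q i j = ?q j i"
        using u by (intro partial_commute[OF _ stars_mem]) (auto simp: cyl_rep_def smooth_on_def)
      then show "?q i j * ?s V i * ?s Z j = ?q j i * ?s Z j * ?s V i" by simp
    qed
    finally have sym: "(\<Sum>i<k. \<Sum>j<k. ?q j i * ?s V j * ?s Z i) = (\<Sum>i<k. \<Sum>j<k. ?q j i * ?s Z j * ?s V i)" .
    have s: "?s W i = (?s (act_components M V Z) i + star (\<lambda>x. V \<mu> x (dir_deriv (Z \<mu>) (f i))) \<mu>)
        - (?s (act_components M Z V) i + star (\<lambda>x. Z \<mu> x (dir_deriv (V \<mu>) (f i))) \<mu>)" for i
    proof -
      have sm: "(\<lambda>x. act_components M V Z \<mu> x h) \<in> Cinf M" "(\<lambda>x. act_components M Z V \<mu> x h) \<in> Cinf M"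
        "(\<lambda>x. V \<mu> x h) \<in> Cinf M" "(\<lambda>x. Z \<mu> x h) \<in> Cinf M" for h
        using V Z by (simp_all only: vfield_Cinf cyl_vfield_at act_components_cyl_vfields)
      show ?thesis
        by (simp add: W_def lift2_def lie_bracket_def star_add star_diff sm Cinf_add Cinf_diff)
    qed
    show ?thesis
      unfolding act_act[OF V Z u] act_act[OF Z V u] sym act_eq[OF u cyl_vfield_at[OF W]] s
      by (simp add: right_diff_distrib sum_subtractf)
  qed
  have uniq: "W' = W" if W': "W' \<in> cyl_vfields M"
    and act_W': "\<forall>u\<in>cyl_funs M. act M W' u = act M V (act M Z u) - act M Z (act M V u)" for W'
  proof -
    \<comment> \<open>Testing on \<open>star f\<close> suffices, since there the action is the
      integral of the derivative of \<open>f\<close>, the quantity that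
      \<open>cyl_vfield_eq_0I\<close> speaks about.\<close>
    have "W' - W = 0"
    proof (rule cyl_vfield_eq_0I[OF cyl_vfields_diff[OF W' W]])
      fix f \<mu> assume f: "f \<in> Cinf M"
      have "act M (W' - W) (star f) \<mu> = 0"
        using act_W' act_W[OF cyl_funs_star[OF f]] cyl_funs_star[OF f]
        by (simp add: act_diff_vfield[OF W' W])
      then show "star (\<lambda>x. (W' - W) \<mu> x f) \<mu> = 0"
        unfolding act_star[OF cyl_vfields_diff[OF W' W] f] .
    qed
    then show ?thesis by simp
  qed
  have "bracket M V Z = W"
    unfolding bracket_def
  proof (rule the_equality)
    show "W \<in> cyl_vfields M \<and> (\<forall>u\<in>cyl_funs M. act M W u = act M V (act M Z u) - act M Z (act M V u))"
      using W act_W by (auto simp: fun_eq_iff)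
  qed (use uniq in blast)
  then show "bracket M V Z = lift2 lie_bracket V Z + act_components M V Z - act_components M Z V"
    and "u \<in> cyl_funs M \<Longrightarrow> act M (bracket M V Z) u \<mu> = act M V (act M Z u) \<mu> - act M Z (act M V u) \<mu>"
    using act_W by (simp_all add: W_def)
qed

lemma bracket_cyl_vfields:
  assumes "V \<in> cyl_vfields M" "Z \<in> cyl_vfields M"
  shows "bracket M V Z \<in> cyl_vfields M"
  unfolding bracket_eq(1)[OF assms]
  by (intro cyl_vfields_diff cyl_vfields_add lift2_cyl_vfields bilinear_lie_bracket act_components_cyl_vfields assms)

text \<open>This is flatness of \<open>nabla_int\<close>: components are cylinder functions, and on
  these the bracket acts as the commutator.\<close>

lemma act_components_bracket:
  assumes V: "V \<in> cyl_vfields M" and Z: "Z \<in> cyl_vfields M" and Y: "Y \<in> cyl_vfields M"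
  shows "act_components M (bracket M V Z) Y
    = act_components M V (act_components M Z Y) - act_components M Z (act_components M V Y)"
  by (intro ext) (simp add: act_components_def bracket_eq(2)[OF V Z cyl_vfield_component[OF Y]])

end

section \<open>Curvature\<close>

locale torsion_free_connection =
  fixes S :: "'a::ab_group_add set" and N L :: "'a \<Rightarrow> 'a \<Rightarrow> 'a"
  assumes diff_mem: "X \<in> S \<Longrightarrow> Y \<in> S \<Longrightarrow> X - Y \<in> S"
    and N_mem: "X \<in> S \<Longrightarrow> Y \<in> S \<Longrightarrow> N X Y \<in> S"
    and N_diff1: "X \<in> S \<Longrightarrow> Y \<in> S \<Longrightarrow> Z \<in> S \<Longrightarrow> N (X - Y) Z = N X Z - N Y Z"
    and N_diff2: "X \<in> S \<Longrightarrow> Y \<in> S \<Longrightarrow> Z \<in> S \<Longrightarrow> N X (Y - Z) = N X Y - N X Z"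
    and torsion_free: "X \<in> S \<Longrightarrow> Y \<in> S \<Longrightarrow> L X Y = N X Y - N Y X"
    and jacobi: "X \<in> S \<Longrightarrow> Y \<in> S \<Longrightarrow> Z \<in> S \<Longrightarrow> L X (L Y Z) + L Y (L Z X) + L Z (L X Y) = 0"
begin

definition curv :: "'a \<Rightarrow> 'a \<Rightarrow> 'a \<Rightarrow> 'a" where
  "curv X Y Z = N X (N Y Z) - N Y (N X Z) - N (L X Y) Z"

lemma L_mem: "X \<in> S \<Longrightarrow> Y \<in> S \<Longrightarrow> L X Y \<in> S"
  by (simp add: torsion_free diff_mem N_mem)

lemma curv_antisym:
  assumes "X \<in> S" "Y \<in> S" "Z \<in> S"
  shows "curv X Y Z = - curv Y X Z"
  using assms by (simp add: curv_def torsion_free N_mem N_diff1)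

lemmas expand = torsion_free L_mem N_mem diff_mem N_diff1 N_diff2

text \<open>In the cyclic sum \<open>N X (N Y Z) - N X (N Z Y)\<close> is
  \<open>N X (L Y Z)\<close>, and together with \<open>- N (L Y Z) X\<close> it becomes
  \<open>L X (L Y Z)\<close>. The three groups form the Jacobi sum.\<close>

lemma first_bianchi:
  assumes "X \<in> S" "Y \<in> S" "Z \<in> S"
  shows "curv X Y Z + curv Y Z X + curv Z X Y = 0"
proof -
  have "curv X Y Z + curv Y Z X + curv Z X Y = L X (L Y Z) + L Y (L Z X) + L Z (L X Y)"
    using assms by (simp add: curv_def expand)
  then show ?thesis using jacobi assms by simp
qed

text \<open>Regard \<open>N X\<close> as an operator. The nested commutators of three such operators
  cancel cyclically; torsion freeness turns the curvature terms with \<open>N V X\<close> and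
  \<open>N X V\<close> into terms with \<open>L V X\<close>, whose commutators cancel as well. What
  remains is \<open>N\<close> applied to a Jacobi sum.\<close>

lemma second_bianchi:
  assumes "X \<in> S" "Y \<in> S" "V \<in> S" "Z \<in> S"
  shows "(N V (curv X Y Z) - curv (N V X) Y Z - curv X (N V Y) Z - curv X Y (N V Z))
    + (N X (curv Y V Z) - curv (N X Y) V Z - curv Y (N X V) Z - curv Y V (N X Z))
    + (N Y (curv V X Z) - curv (N Y V) X Z - curv V (N Y X) Z - curv V X (N Y Z)) = 0" (is "?lhs = 0")
proof -
  \<comment> \<open>This provides \<open>N 0 Z = 0\<close>, with zero written as a difference
    because the axioms speak of differences.\<close>
  have "N (Z - Z) Z = N Z Z - N Z Z" using assms by (intro N_diff1)
  moreover have "L V (L X Y) - L (L Y V) X - L (L V X) Y = 0"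
    using jacobi[OF assms(3,1,2)] assms by (simp add: torsion_free[of "L _ _"] torsion_free[of _ "L _ _"] L_mem algebra_simps)
  ultimately have "N (L V (L X Y) - L (L Y V) X - L (L V X) Y) Z = 0" by simp
  \<comment> \<open>The Jacobi identity under \<open>N _ Z\<close>, with every \<open>L\<close>
    resolved: both sides are brought to signed sums of words in \<open>N\<close> so that they can be
    compared term by term.\<close>
  then have "N (N V (N X Y)) Z - N (N V (N Y X)) Z - (N (N (N X Y) V) Z - N (N (N Y X) V) Z)
      - (N (N (N Y V) X) Z - N (N (N V Y) X) Z - (N (N X (N Y V)) Z - N (N X (N V Y)) Z))
      - (N (N (N V X) Y) Z - N (N (N X V) Y) Z - (N (N Y (N V X)) Z - N (N Y (N X V)) Z)) = 0"
    (is "?jacobi = 0")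
    using assms by (simp add: expand)
  moreover have "?lhs = - ?jacobi"
    using assms by (simp add: curv_def expand)
  ultimately show ?thesis by simp
qed

end

text \<open>A real factor is a constant function; its derivative vanishes, so the Leibniz rule of
  the connection reduces to homogeneity.\<close>

lemma (in closed_manifold) bilinear_affine_connection:
  assumes "affine_connection M nab"
  shows "bilinear_vfields M nab"
  unfolding bilinear_vfields_def
proof (intro ballI conjI allI)
  fix X Y c assume XY: "X \<in> vfields M" "Y \<in> vfields M"
  show "nab X Y \<in> vfields M"
    using assms XY by (simp add: affine_connection_def)
  have c: "(\<lambda>x \<phi>. c * Z x \<phi>) = fscale (\<lambda>x. c) Z" for Z :: "'m vfield"
    by (simp add: fscale_def)
  have "dir_deriv X (\<lambda>x. c) = (\<lambda>x. 0)"
    using tangent_const[OF vfields_tangent[OF XY(1)]] by (simp add: dir_deriv_def)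
  then have "fscale (dir_deriv X (\<lambda>x. c)) Y = 0"
    by (simp add: fscale_def fun_eq_iff)
  moreover have "nab (fscale (\<lambda>x. c) X) Y = fscale (\<lambda>x. c) (nab X Y)"
    "nab X (fscale (\<lambda>x. c) Y) = fscale (dir_deriv X (\<lambda>x. c)) Y + fscale (\<lambda>x. c) (nab X Y)"
    using assms XY Cinf_const unfolding affine_connection_def by blast+
  ultimately show "nab (\<lambda>x \<phi>. c * X x \<phi>) Y = (\<lambda>x \<phi>. c * nab X Y x \<phi>)"
    "nab X (\<lambda>x \<phi>. c * Y x \<phi>) = (\<lambda>x \<phi>. c * nab X Y x \<phi>)"
    by (simp_all only: c add_0_left)
next
  fix X Y Z assume "X \<in> vfields M" "Y \<in> vfields M" "Z \<in> vfields M"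
  then show "nab (X + Z) Y = nab X Y + nab Z Y" "nab X (Y + Z) = nab X Y + nab X Z"
    using assms unfolding affine_connection_def by blast+
qed

section \<open>The metric and the Riemann tensor of the manifold\<close>

locale riemannian_closed_manifold = closed_manifold M
  for M :: "'m::{t2_space, second_countable_topology} manifold" +
  fixes g :: "'m \<Rightarrow> 'm vec \<Rightarrow> 'm vec \<Rightarrow> real"
    and nab :: "'m vfield \<Rightarrow> 'm vfield \<Rightarrow> 'm vfield"
  assumes metric: "riemannian_metric M g"
    and levi_civita: "levi_civita M g nab"
begin

lemma bilinear_nab: "bilinear_vfields M nab"
  using bilinear_affine_connection levi_civita by (simp add: levi_civita_def)

lemmas nab_mem = bilinear_vfields_mem[OF bilinear_nab]

lemma nab_torsion_free: "X \<in> vfields M \<Longrightarrow> Y \<in> vfields M \<Longrightarrow> lie_bracket X Y = nab X Y - nab Y X"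
  using levi_civita by (simp add: levi_civita_def)

lemma metric_compatible:
  "X \<in> vfields M \<Longrightarrow> Y \<in> vfields M \<Longrightarrow> Z \<in> vfields M \<Longrightarrow>
    X x (\<lambda>y. g y (Y y) (Z y)) = g x (nab X Y x) (Z x) + g x (Y x) (nab X Z x)"
  using levi_civita by (simp add: levi_civita_def dir_deriv_def)

lemma metric_Cinf: "X \<in> vfields M \<Longrightarrow> Y \<in> vfields M \<Longrightarrow> (\<lambda>x. g x (X x) (Y x)) \<in> Cinf M"
  using metric by (simp add: riemannian_metric_def)

lemma metric_sym: "X \<in> vfields M \<Longrightarrow> Y \<in> vfields M \<Longrightarrow> g x (X x) (Y x) = g x (Y x) (X x)"
  using metric vfields_tangent by (simp add: riemannian_metric_def)

lemma metric_add:
  assumes "X \<in> vfields M" "Y \<in> vfields M" "Z \<in> vfields M"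
  shows "g x ((X + Y) x) (Z x) = g x (X x) (Z x) + g x (Y x) (Z x)"
proof -
  have "g x (X x + Y x) (Z x) = g x (X x) (Z x) + g x (Y x) (Z x)"
    using metric assms[THEN vfields_tangent] unfolding riemannian_metric_def by blast
  then show ?thesis by simp
qed

lemma metric_diff:
  assumes "X \<in> vfields M" "Y \<in> vfields M" "Z \<in> vfields M"
  shows "g x ((X - Y) x) (Z x) = g x (X x) (Z x) - g x (Y x) (Z x)"
  using metric_add[OF vfields_diff[OF assms(1,2)] assms(2,3)] by simp

definition curvature :: "'m vfield \<Rightarrow> 'm vfield \<Rightarrow> 'm vfield \<Rightarrow> 'm vfield" where
  "curvature X Y Z = nab X (nab Y Z) - nab Y (nab X Z) - nab (lie_bracket X Y) Z"

text \<open>The derivative of the function \<open>g(Z, W)\<close> along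
  \<open>lie_bracket X Y\<close> is computed twice: directly by metric compatibility, and as a
  commutator of second derivatives, in which the terms with one derivative on each of
  \<open>Z\<close> and \<open>W\<close> cancel.\<close>

lemma curvature_metric_skew:
  assumes X: "X \<in> vfields M" and Y: "Y \<in> vfields M" and Z: "Z \<in> vfields M" and W: "W \<in> vfields M"
  shows "g x (curvature X Y Z x) (W x) = - g x (curvature X Y W x) (Z x)"
proof -
  note L = lie_bracket_vfields[OF X Y]
  have second: "A x (dir_deriv B (\<lambda>y. g y (Z y) (W y)))
      = (g x (nab A (nab B Z) x) (W x) + g x (nab B Z x) (nab A W x))
        + (g x (nab A Z x) (nab B W x) + g x (Z x) (nab A (nab B W) x))"
    if A: "A \<in> vfields M" and B: "B \<in> vfields M" for A B
  proof -
    have "dir_deriv B (\<lambda>y. g y (Z y) (W y)) = (\<lambda>x. g x (nab B Z x) (W x) + g x (Z x) (nab B W x))"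
      by (rule ext) (simp add: dir_deriv_def metric_compatible[OF B Z W])
    then show ?thesis
      using tangent_add[OF vfields_tangent[OF A] metric_Cinf[OF nab_mem[OF B Z] W] metric_Cinf[OF Z nab_mem[OF B W]]]
      by (simp add: metric_compatible A B Z W nab_mem)
  qed
  have "lie_bracket X Y x (\<lambda>y. g y (Z y) (W y))
      = g x (nab X (nab Y Z) x) (W x) - g x (nab Y (nab X Z) x) (W x)
        + (g x (Z x) (nab X (nab Y W) x) - g x (Z x) (nab Y (nab X W) x))"
    by (simp add: lie_bracket_def second X Y)
  moreover have "lie_bracket X Y x (\<lambda>y. g y (Z y) (W y))
      = g x (nab (lie_bracket X Y) Z x) (W x) + g x (Z x) (nab (lie_bracket X Y) W x)"
    by (rule metric_compatible[OF L Z W])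
  moreover have "g x (curvature X Y A x) (B x) = g x (nab X (nab Y A) x) (B x)
      - g x (nab Y (nab X A) x) (B x) - g x (nab (lie_bracket X Y) A x) (B x)"
    if "A \<in> vfields M" "B \<in> vfields M" for A B
    unfolding curvature_def using that X Y L by (simp only: metric_diff vfields_diff nab_mem)
  moreover have "g x (Z x) (A x) = g x (A x) (Z x)" if "A \<in> vfields M" for A
    by (rule metric_sym[OF Z that])
  ultimately show ?thesis
    using X Y Z W L nab_mem by simp
qed

section \<open>The connection \<open>nabla_LC\<close> and its curvature\<close>

lemma nabla_LC_eq:
  "V \<in> cyl_vfields M \<Longrightarrow> Z \<in> cyl_vfields M \<Longrightarrow> nabla_LC M nab V Z = act_components M V Z + lift2 nab V Z"
  by (simp only: nabla_LC_def nabla_int_eq Omega_LC_def lift2_def)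

lemma nabla_LC_mem: "V \<in> cyl_vfields M \<Longrightarrow> Z \<in> cyl_vfields M \<Longrightarrow> nabla_LC M nab V Z \<in> cyl_vfields M"
  by (simp only: nabla_LC_eq cyl_vfields_add act_components_cyl_vfields lift2_cyl_vfields[OF bilinear_nab])

lemma bracket_torsion_free:
  assumes V: "V \<in> cyl_vfields M" and Z: "Z \<in> cyl_vfields M"
  shows "bracket M V Z = nabla_LC M nab V Z - nabla_LC M nab Z V"
proof -
  have "lift2 lie_bracket V Z = lift2 nab V Z - lift2 nab Z V"
  proof (rule ext)
    fix \<mu>
    show "lift2 lie_bracket V Z \<mu> = (lift2 nab V Z - lift2 nab Z V) \<mu>"
      using nab_torsion_free[OF cyl_vfield_at[OF V] cyl_vfield_at[OF Z], of \<mu> \<mu>]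
      by (simp only: lift2_def minus_apply)
  qed
  then show ?thesis
    by (simp only: bracket_eq[OF V Z] nabla_LC_eq V Z) (simp only: algebra_simps)
qed

text \<open>Brackets act as commutators of operators on cylinder functions, for which the Jacobi
  identity is formal. Applied to \<open>star f\<close>, this gives the vanishing integrals from
  which \<open>cyl_vfield_eq_0I\<close> recovers the identity of fields.\<close>

lemma bracket_jacobi:
  assumes X: "X \<in> cyl_vfields M" and Y: "Y \<in> cyl_vfields M" and Z: "Z \<in> cyl_vfields M"
  shows "bracket M X (bracket M Y Z) + bracket M Y (bracket M Z X) + bracket M Z (bracket M X Y) = 0"
    (is "?W = 0")
proof (rule cyl_vfield_eq_0I)
  show W: "?W \<in> cyl_vfields M"
    by (intro cyl_vfields_add bracket_cyl_vfields assms)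
  fix f \<mu> assume f: "f \<in> Cinf M"
  have act_bracket_fun: "act M (bracket M A B) u = (\<lambda>\<mu>. act M A (act M B u) \<mu> - act M B (act M A u) \<mu>)"
    if "A \<in> cyl_vfields M" "B \<in> cyl_vfields M" "u \<in> cyl_funs M" for A B u
    using bracket_eq(2)[OF that] by (rule ext)
  have act_diff: "act M A (\<lambda>\<mu>. u \<mu> - v \<mu>) \<mu> = act M A u \<mu> - act M A v \<mu>"
    if "A \<in> cyl_vfields M" "u \<in> cyl_funs M" "v \<in> cyl_funs M" for A u v
    using act_add[OF that(1,2) cyl_funs_minus[OF that(3)]] act_cmult[OF that(1,3), of "-1"] by simp
  note u = cyl_funs_star[OF f]
  have "act M ?W (star f) \<mu> = act M (bracket M X (bracket M Y Z)) (star f) \<mu>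
      + act M (bracket M Y (bracket M Z X)) (star f) \<mu> + act M (bracket M Z (bracket M X Y)) (star f) \<mu>"
    by (simp only: act_add_vfield cyl_vfields_add bracket_cyl_vfields assms u)
  also have "\<dots> = 0"
    by (simp add: act_bracket_fun act_diff act_cyl_funs bracket_cyl_vfields assms u)
  finally show "star (\<lambda>x. ?W \<mu> x f) \<mu> = 0"
    by (simp only: act_star[OF W f])
qed

sublocale cyl: torsion_free_connection "cyl_vfields M" "nabla_LC M nab" "bracket M"
proof
  fix X Y Z assume mem: "X \<in> cyl_vfields M" "Y \<in> cyl_vfields M" "Z \<in> cyl_vfields M"
  show "nabla_LC M nab (X - Y) Z = nabla_LC M nab X Z - nabla_LC M nab Y Z"
    by (simp only: nabla_LC_eq mem cyl_vfields_diff act_components_vfield_diff lift2_diff1[OF bilinear_nab])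
      (simp only: algebra_simps)
  show "nabla_LC M nab X (Y - Z) = nabla_LC M nab X Y - nabla_LC M nab X Z"
    by (simp only: nabla_LC_eq mem cyl_vfields_diff act_components_diff lift2_diff2[OF bilinear_nab])
      (simp only: algebra_simps)
qed (rule cyl_vfields_diff nabla_LC_mem bracket_torsion_free bracket_jacobi; assumption)+

lemma R_der_eq_curv: "R_der M nab X Y Z = cyl.curv X Y Z"
  by (simp only: R_der_def cyl.curv_def)

text \<open>The terms of \<open>\<nabla>\<^sup>i\<^sup>n\<^sup>t\<close> cancel because \<open>V\<close> acts as a derivation on \<open>lift2 nab\<close>.\<close>

lemma R_der_at:
  assumes X: "X \<in> cyl_vfields M" and Y: "Y \<in> cyl_vfields M" and Z: "Z \<in> cyl_vfields M"
  shows "R_der M nab X Y Z \<mu> = curvature (X \<mu>) (Y \<mu>) (Z \<mu>)"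
proof -
  let ?N = "lift2 nab" and ?D = "act_components M"
  note mem = X Y Z act_components_cyl_vfields lift2_cyl_vfields[OF bilinear_nab] lift2_cyl_vfields[OF bilinear_lie_bracket]
    cyl_vfields_add cyl_vfields_diff bracket_cyl_vfields
  \<comment> \<open>Exchanging \<open>A\<close> and \<open>B\<close> exchanges the terms
    \<open>?N B (?D A Z)\<close> and \<open>?N A (?D B Z)\<close>, so they cancel in the curvature.
    The terms \<open>?N (?D A B) Z\<close> and \<open>?D A (?D B Z)\<close> are removed by the
    bracket, the latter by flatness of \<open>nabla_int\<close>.\<close>
  have *: "nabla_LC M nab A (nabla_LC M nab B Z) = ?D A (?D B Z) + (?N (?D A B) Z + ?N B (?D A Z))
      + (?N A (?D B Z) + ?N A (?N B Z))" if "A \<in> cyl_vfields M" "B \<in> cyl_vfields M" for A B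
    by (simp only: nabla_LC_eq mem that act_components_add lift2_add2[OF bilinear_nab]
        act_components_lift2[OF bilinear_nab])
  have "nabla_LC M nab (bracket M X Y) Z = (?D X (?D Y Z) - ?D Y (?D X Z))
      + (?N (lift2 lie_bracket X Y) Z + ?N (?D X Y) Z - ?N (?D Y X) Z)"
    by (simp only: nabla_LC_eq mem act_components_bracket)
      (simp only: bracket_eq(1) mem lift2_add1[OF bilinear_nab] lift2_diff1[OF bilinear_nab])
  then have "R_der M nab X Y Z = ?N X (?N Y Z) - ?N Y (?N X Z) - ?N (lift2 lie_bracket X Y) Z"
    by (simp only: R_der_def * X Y) (simp only: algebra_simps)
  then show ?thesis
    by (simp only: lift2_def curvature_def minus_apply)
qed

lemma R_der_mem:
  "X \<in> cyl_vfields M \<Longrightarrow> Y \<in> cyl_vfields M \<Longrightarrow> Z \<in> cyl_vfields M \<Longrightarrow> R_der M nab X Y Z \<in> cyl_vfields M"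
  unfolding R_der_def by (intro cyl_vfields_diff nabla_LC_mem bracket_cyl_vfields)

section \<open>Symmetries of the curvature with respect to \<open>G_der\<close>\<close>

lemma G_der_add:
  assumes "X \<in> cyl_vfields M" "Y \<in> cyl_vfields M" "Z \<in> cyl_vfields M"
  shows "G_der g (X + Y) Z \<mu> = G_der g X Z \<mu> + G_der g Y Z \<mu>"
proof -
  note at = assms[THEN cyl_vfield_at, of \<mu>]
  have "g x ((X + Y) \<mu> x) (Z \<mu> x) = g x (X \<mu> x) (Z \<mu> x) + g x (Y \<mu> x) (Z \<mu> x)" for x
    using metric_add[OF at] by simp
  then show ?thesis
    using at by (simp add: G_der_def integrable_meas metric_Cinf)
qed

lemma G_der_R_der_skew:
  assumes "X \<in> cyl_vfields M" "Y \<in> cyl_vfields M" "Z \<in> cyl_vfields M" "W \<in> cyl_vfields M"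
  shows "G_der g (R_der M nab X Y Z) W \<mu> = - G_der g (R_der M nab X Y W) Z \<mu>"
  using curvature_metric_skew[OF assms[THEN cyl_vfield_at, of \<mu>]]
  by (simp add: G_der_def R_der_at assms)

lemma G_der_zero: "Z \<in> cyl_vfields M \<Longrightarrow> G_der g 0 Z \<mu> = 0"
  using G_der_add[OF cyl_vfields_zero cyl_vfields_zero, of Z \<mu>] by simp

lemma G_der_R_der_antisym:
  assumes X: "X \<in> cyl_vfields M" and Y: "Y \<in> cyl_vfields M" and Z: "Z \<in> cyl_vfields M" and W: "W \<in> cyl_vfields M"
  shows "G_der g (R_der M nab X Y Z) W \<mu> = - G_der g (R_der M nab Y X Z) W \<mu>"
proof -
  have "R_der M nab X Y Z + R_der M nab Y X Z = 0"
    using cyl.curv_antisym[OF X Y Z] by (simp only: R_der_eq_curv left_minus)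
  then show ?thesis
    using G_der_add[OF R_der_mem[OF X Y Z] R_der_mem[OF Y X Z] W, of \<mu>] G_der_zero[OF W, of \<mu>]
    by simp
qed

lemma G_der_R_der_bianchi:
  assumes X: "X \<in> cyl_vfields M" and Y: "Y \<in> cyl_vfields M" and Z: "Z \<in> cyl_vfields M" and W: "W \<in> cyl_vfields M"
  shows "G_der g (R_der M nab X Y Z) W \<mu> + G_der g (R_der M nab Y Z X) W \<mu> + G_der g (R_der M nab Z X Y) W \<mu> = 0"
  using cyl.first_bianchi[OF X Y Z] G_der_zero[OF W, of \<mu>]
  by (simp only: R_der_eq_curv[symmetric] G_der_add[symmetric] R_der_mem cyl_vfields_add X Y Z W)

text \<open>The classical octahedron argument. Take the first Bianchi identity for the four cyclic
  rotations of \<open>A B C D\<close> and subtract the last two from the sum of the first two: the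
  skew symmetries in each pair cancel all terms except twice the two sides of the claim.\<close>

lemma G_der_R_der_pair_sym:
  assumes a: "A \<in> cyl_vfields M" and b: "B \<in> cyl_vfields M" and c: "C \<in> cyl_vfields M" and d: "D \<in> cyl_vfields M"
  shows "G_der g (R_der M nab A B C) D \<mu> = G_der g (R_der M nab C D A) B \<mu>"
  using G_der_R_der_bianchi[OF a b c d, of \<mu>] G_der_R_der_bianchi[OF b c d a, of \<mu>]
    G_der_R_der_bianchi[OF c d a b, of \<mu>] G_der_R_der_bianchi[OF d a b c, of \<mu>]
    G_der_R_der_skew[OF b c a d, of \<mu>] G_der_R_der_skew[OF c a b d, of \<mu>] G_der_R_der_skew[OF a b c d, of \<mu>]
    G_der_R_der_skew[OF c d b a, of \<mu>] G_der_R_der_skew[OF d b c a, of \<mu>] G_der_R_der_skew[OF d a c b, of \<mu>]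
    G_der_R_der_antisym[OF c a b d, of \<mu>] G_der_R_der_antisym[OF c a d b, of \<mu>]
    G_der_R_der_antisym[OF d b a c, of \<mu>] G_der_R_der_antisym[OF d b c a, of \<mu>]
  by linarith

end

theorem proposition2p24:
  fixes M :: "'m::{t2_space, second_countable_topology} manifold"
    and g :: "'m \<Rightarrow> 'm vec \<Rightarrow> 'm vec \<Rightarrow> real"
    and nab :: "'m vfield \<Rightarrow> 'm vfield \<Rightarrow> 'm vfield"
    and V1 V2 V3 V4 :: "'m cvfield"
  assumes "oriented_smooth_manifold M"
    and "compact (UNIV :: 'm set)"
    and "connected (UNIV :: 'm set)"
    and "riemannian_metric M g"
    and "levi_civita M g nab"
    and "V1 \<in> cyl_vfields M" "V2 \<in> cyl_vfields M" "V3 \<in> cyl_vfields M" "V4 \<in> cyl_vfields M"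
  shows "(\<forall>Z\<in>cyl_vfields M. R_der M nab V1 V2 Z = - R_der M nab V2 V1 Z)
    \<and> G_der g (R_der M nab V1 V2 V3) V4 = - G_der g (R_der M nab V1 V2 V4) V3
    \<and> G_der g (R_der M nab V1 V2 V3) V4 = G_der g (R_der M nab V3 V4 V1) V2
    \<and> R_der M nab V1 V2 V3 + R_der M nab V2 V3 V1 + R_der M nab V3 V1 V2 = 0
    \<and> (\<forall>Z\<in>cyl_vfields M. nabla_R_der M nab V1 V2 V3 Z + nabla_R_der M nab V2 V3 V1 Z
           + nabla_R_der M nab V3 V1 V2 Z = 0)"
proof -
  interpret riemannian_closed_manifold M g nab
    using assms(1,2,4,5) by unfold_locales (simp_all add: oriented_smooth_manifold_def)
  note V = assms(6-9)
  have "R_der M nab V1 V2 Z = - R_der M nab V2 V1 Z" if "Z \<in> cyl_vfields M" for Z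
    unfolding R_der_eq_curv by (rule cyl.curv_antisym[OF V(1,2) that])
  moreover have "G_der g (R_der M nab V1 V2 V3) V4 = - G_der g (R_der M nab V1 V2 V4) V3"
    by (rule ext) (simp add: G_der_R_der_skew[OF V])
  moreover have "G_der g (R_der M nab V1 V2 V3) V4 = G_der g (R_der M nab V3 V4 V1) V2"
    by (rule ext) (rule G_der_R_der_pair_sym[OF V])
  moreover have "R_der M nab V1 V2 V3 + R_der M nab V2 V3 V1 + R_der M nab V3 V1 V2 = 0"
    unfolding R_der_eq_curv by (rule cyl.first_bianchi[OF V(1-3)])
  moreover have "nabla_R_der M nab V1 V2 V3 Z + nabla_R_der M nab V2 V3 V1 Z
      + nabla_R_der M nab V3 V1 V2 Z = 0" if "Z \<in> cyl_vfields M" for Z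
    unfolding nabla_R_der_def R_der_eq_curv by (rule cyl.second_bianchi[OF V(2,3,1) that])
  ultimately show ?thesis by blast
qed


end
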